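(* Let $\mathcal{E}=\tilde f-f$ be the error process. For all $x,y\in\mathbb{R}^D\times\mathbb{R}^D$, with $\Delta x=x-z$ and $\Delta y=y-z$, its covariance function $k_{\mathcal{E}}(x,y)=\operatorname{Cov}(\mathcal{E}(x),\mathcal{E}(y))$ is $$\begin{aligned}k_{\mathcal{E}}(x,y)={}&2\Big(h\big(\|x-y\|_2^2\big)-h\big(\|x-y^{flip}\|_2^2\big)\Big)\\&+4\Big(h'\big(\|\Delta x\|_2^2\big)+h'\big(\|\Delta y\|_2^2\big)-h'(0)\Big)\Big(\langle\Delta x,\Delta y\rangle_2-\langle\Delta x,(\Delta y)^{flip}\rangle_2\Big)\\&-4\Big(h''\big(\|\Delta x\|_2^2\big)+h''\big(\|\Delta y\|_2^2\big)-h''(0)\Big)\Big(\langle\Delta x,\Delta y\rangle_2^2-\langle\Delta x,(\Delta y)^{flip}\rangle_2^2\Big).\end{aligned}$$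
   Context: Let $D\ge 1$ and write points of $\mathbb{R}^D\times\mathbb{R}^D$ as $x=(x^{(1)},x^{(2)})$, with $x^{flip}=(x^{(2)},x^{(1)})$; $\langle\cdot,\cdot\rangle_2$ is the Euclidean inner product on $\mathbb{R}^{2D}$. A real-valued random field is Gaussian if every finite linear combination of its values is a (possibly degenerate) Gaussian random variable. Let $u$ be a mean-zero isotropic Gaussian field on $\mathbb{R}^D\times\mathbb{R}^D$ with covariance function $k_u(x,y)=h(\|x-y\|_2^2)$, where $h:[0,\infty)\to\mathbb{R}$. The field $f(x)=u(x)-u(x^{flip})$ is called a block isotropic Gaussian field with base field $u$; its covariance function is denoted $k_f$. Standing smoothness assumption: $k_u$ (hence $k_f$) is four times continuously differentiable, and $h$ is twice continuously differentiable on $[0,\infty)$. Derivatives of $f$ are taken in the mean-square ($L^2(\Omega)$) sense. Fix $z^*\in\mathbb{R}^D$ and $z=(z^*,z^* )$. Define $$g_i=\partial_{x^{(1)}_i}f(x)\big|_{x=z},\quad H^{(1,1)}_{i,j}=\partial_{x^{(1)}_i}\partial_{x^{(1)}_j}f(x)\big|_{x=z},\quad H^{(1,2)}_{i,j}=\partial_{x^{(1)}_i}\partial_{x^{(2)}_j}f(x)\big|_{x=z}.$$ The second-order (skew-symmetric) Taylor approximation of $f$ at $z$ is $$\tilde f(x)=g^{\mathsf T}(v-w)+\tfrac12\big(v^{\mathsf T}H^{(1,1)}v-w^{\mathsf T}H^{(1,1)}w\big)+v^{\mathsf T}H^{(1,2)}w,\qquad v=x^{(1)}-z^*,\ w=x^{(2)}-z^*.$$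 *)

theory Defs
  imports "HOL-Probability.Probability"
begin

definition covariance :: "'w measure \<Rightarrow> ('w \<Rightarrow> real) \<Rightarrow> ('w \<Rightarrow> real) \<Rightarrow> real" where
  "covariance M X Y =
     (\<integral>\<omega>. (X \<omega> - (\<integral>\<omega>. X \<omega> \<partial>M)) * (Y \<omega> - (\<integral>\<omega>. Y \<omega> \<partial>M)) \<partial>M)"

(* The second disjunct is the degenerate Gaussian of variance 0. *)
definition gaussian_rv :: "'w measure \<Rightarrow> ('w \<Rightarrow> real) \<Rightarrow> bool" where
  "gaussian_rv M X \<longleftrightarrow> X \<in> borel_measurable M \<and>
     (\<exists>\<mu> \<sigma>. (0 < \<sigma> \<and> distributed M lborel X (normal_density \<mu> \<sigma>)) \<or>
            (AE \<omega> in M. X \<omega> = \<mu>))"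

definition gaussian_field :: "'w measure \<Rightarrow> ('a \<Rightarrow> 'w \<Rightarrow> real) \<Rightarrow> bool" where
  "gaussian_field M u \<longleftrightarrow>
     (\<forall>S c. finite S \<longrightarrow> gaussian_rv M (\<lambda>\<omega>. \<Sum>x\<in>S. c x * u x \<omega>))"

fun n_times_cont_diff :: "nat \<Rightarrow> ('a::euclidean_space \<Rightarrow> real) \<Rightarrow> bool" where
  "n_times_cont_diff 0 F \<longleftrightarrow> continuous_on UNIV F"
| "n_times_cont_diff (Suc n) F \<longleftrightarrow>
     (\<forall>x. F differentiable (at x)) \<and>
     (\<forall>v. n_times_cont_diff n (\<lambda>x. frechet_derivative F (at x) v))"

(* The limit is taken with the nonnegative integral, which is infinite (not 0) on
   functions that are not integrable. *)
definition has_ms_derivative ::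
    "'w measure \<Rightarrow> ('a::real_vector \<Rightarrow> 'w \<Rightarrow> real) \<Rightarrow> 'a \<Rightarrow> 'a \<Rightarrow> ('w \<Rightarrow> real) \<Rightarrow> bool" where
  "has_ms_derivative M F e x Y \<longleftrightarrow>
     Y \<in> borel_measurable M \<and> integrable M (\<lambda>\<omega>. (Y \<omega>)\<^sup>2) \<and>
     ((\<lambda>t::real. \<integral>\<^sup>+\<omega>. ennreal (((F (x + t *\<^sub>R e) \<omega> - F x \<omega>) / t - Y \<omega>)\<^sup>2) \<partial>M)
        \<longlongrightarrow> 0) (at 0)"

(* A mean-square derivative is determined only up to null sets; this picks a version.
   The value is unspecified if there is no derivative. *)
definition ms_deriv ::
    "'w measure \<Rightarrow> ('a::real_vector \<Rightarrow> 'w \<Rightarrow> real) \<Rightarrow> 'a \<Rightarrow> 'a \<Rightarrow> 'w \<Rightarrow> real" where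
  "ms_deriv M F e x = (SOME Y. has_ms_derivative M F e x Y)"

definition e1 :: "'d::finite \<Rightarrow> (real^'d) \<times> (real^'d)" where
  "e1 i = (axis i 1, 0)"

definition e2 :: "'d::finite \<Rightarrow> (real^'d) \<times> (real^'d)" where
  "e2 i = (0, axis i 1)"

(* prod.swap is the flip of the two blocks. *)
definition block_field ::
    "('a \<times> 'a \<Rightarrow> 'w \<Rightarrow> real) \<Rightarrow> 'a \<times> 'a \<Rightarrow> 'w \<Rightarrow> real" where
  "block_field u x \<omega> = u x \<omega> - u (prod.swap x) \<omega>"

definition grad1 ::
    "'w measure \<Rightarrow> ((real^'d::finite) \<times> (real^'d) \<Rightarrow> 'w \<Rightarrow> real) \<Rightarrow> (real^'d) \<times> (real^'d)
      \<Rightarrow> 'w \<Rightarrow> real^'d" where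
  "grad1 M f z \<omega> = (\<chi> i. ms_deriv M f (e1 i) z \<omega>)"

definition hess11 ::
    "'w measure \<Rightarrow> ((real^'d::finite) \<times> (real^'d) \<Rightarrow> 'w \<Rightarrow> real) \<Rightarrow> (real^'d) \<times> (real^'d)
      \<Rightarrow> 'w \<Rightarrow> real^'d^'d" where
  "hess11 M f z \<omega> = (\<chi> i j. ms_deriv M (ms_deriv M f (e1 j)) (e1 i) z \<omega>)"

definition hess12 ::
    "'w measure \<Rightarrow> ((real^'d::finite) \<times> (real^'d) \<Rightarrow> 'w \<Rightarrow> real) \<Rightarrow> (real^'d) \<times> (real^'d)
      \<Rightarrow> 'w \<Rightarrow> real^'d^'d" where
  "hess12 M f z \<omega> = (\<chi> i j. ms_deriv M (ms_deriv M f (e2 j)) (e1 i) z \<omega>)"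

definition skew_taylor2 ::
    "'w measure \<Rightarrow> ((real^'d::finite) \<times> (real^'d) \<Rightarrow> 'w \<Rightarrow> real) \<Rightarrow> real^'d
      \<Rightarrow> (real^'d) \<times> (real^'d) \<Rightarrow> 'w \<Rightarrow> real" where
  "skew_taylor2 M f zs x \<omega> =
     (let z = (zs, zs); v = fst x - zs; w = snd x - zs in
        grad1 M f z \<omega> \<bullet> (v - w)
        + 1/2 * (v \<bullet> (hess11 M f z \<omega> *v v) - w \<bullet> (hess11 M f z \<omega> *v w))
        + v \<bullet> (hess12 M f z \<omega> *v w))"

definition error_process ::
    "'w measure \<Rightarrow> ((real^'d::finite) \<times> (real^'d) \<Rightarrow> 'w \<Rightarrow> real) \<Rightarrow> real^'d
      \<Rightarrow> (real^'d) \<times> (real^'d) \<Rightarrow> 'w \<Rightarrow> real" where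
  "error_process M f zs x \<omega> = skew_taylor2 M f zs x \<omega> - f x \<omega>"

end

theory Submission
  imports Defs
begin

text \<open>
  The error is a centered square-integrable random variable, so its covariance is an inner product in
  the Hilbert space of square-integrable random variables, and every inner product that occurs
  can be read off from the kernel
  \<open>k(a, b) = 2 (h(|a - b|\<^sup>2) - h(|a - swap b|\<^sup>2))\<close> of \<open>f\<close>.

  First, the mean-square derivatives in the Taylor coefficients exist. By completeness it is
  enough that the inner products of two difference quotients converge as both increments tend
  to 0. These inner products are mixed second difference quotients of the kernel, and so converge
  to a mixed derivative (\<open>has_ms_derivative_ms_deriv\<close>). The derived field has that
  mixed derivative as its kernel, with two orders of smoothness less; four orders therefore give
  two derivatives.

  Second, taking the inner product with a fixed variable \<open>Z\<close> commutes with mean-square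
  differentiation (\<open>has_real_derivative_expectation_mult\<close>). Two consequences carry the
  proof. The inner products of \<open>f(y)\<close> with the first and second derivatives at
  \<open>z = (zs, zs)\<close> are derivatives of \<open>k(y, .)\<close> at \<open>z\<close>. They are explicit
  because \<open>|z - y| = |z - swap y|\<close>, which also makes the terms in \<open>h'\<close> cancel
  from the second derivative; summing over coordinates gives
  \<open>expectation_f_skew_taylor2\<close>, the two cross terms of the covariance. And a variable that is
  orthogonal to all values of \<open>f\<close> is orthogonal to all its derivatives
  (\<open>orthogonal_D1\<close>, \<open>orthogonal_D2\<close>).

  For the remaining term, the inner product of two Taylor approximations, the approximation at
  \<open>y\<close> is compared with the Taylor polynomial along the ray from \<open>z\<close> through \<open>y\<close>,
  which uses only directional derivatives along \<open>y - z\<close>. Both have the same inner products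
  with all values of \<open>f\<close>, so their difference is orthogonal to every derivative, and one may
  replace the other (\<open>expectation_skew_taylor2_ray_taylor2\<close>). What is left is the second-order
  expansion at 0 of the one-variable function
  \<open>s \<mapsto> - 4 P s h'(s\<^sup>2 |y - z|\<^sup>2) + 4 Q s\<^sup>2 h''(s\<^sup>2 |y - z|\<^sup>2)\<close>,
  where \<open>P\<close> and \<open>Q\<close> are the two differences of inner products and of their squares in the
  asserted formula. It gives \<open>- 4 P h'(0) + 4 Q h''(0)\<close>. Here \<open>h''\<close> is merely continuous, so the
  coefficients come from uniqueness of limits and not from the product rule.
\<close>

section \<open>The Hilbert space of square-integrable random variables\<close>

definition L2 :: "'w measure \<Rightarrow> ('w \<Rightarrow> real) set" where
  "L2 M = {X. X \<in> borel_measurable M \<and> integrable M (\<lambda>\<omega>. (X \<omega>)\<^sup>2)}"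

lemma L2_measurable: "X \<in> L2 M \<Longrightarrow> X \<in> borel_measurable M"
  by (simp add: L2_def)

lemma L2_integrable_square: "X \<in> L2 M \<Longrightarrow> integrable M (\<lambda>\<omega>. (X \<omega>)\<^sup>2)"
  by (simp add: L2_def)

lemma L2_integrable_mult:
  assumes "X \<in> L2 M" "Y \<in> L2 M"
  shows "integrable M (\<lambda>\<omega>. X \<omega> * Y \<omega>)"
proof (rule Bochner_Integration.integrable_bound)
  show "integrable M (\<lambda>\<omega>. (X \<omega>)\<^sup>2 + (Y \<omega>)\<^sup>2)"
    using assms by (simp add: L2_def)
  show "(\<lambda>\<omega>. X \<omega> * Y \<omega>) \<in> borel_measurable M"
    using assms by (intro borel_measurable_times L2_measurable)
  have "\<bar>a * b\<bar> \<le> a\<^sup>2 + b\<^sup>2" for a b :: real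
    using sum_squares_bound[of a b] sum_squares_bound[of a "- b"]
    by (simp add: abs_le_iff)
  then show "AE \<omega> in M. norm (X \<omega> * Y \<omega>) \<le> norm ((X \<omega>)\<^sup>2 + (Y \<omega>)\<^sup>2)"
    by auto
qed

lemma L2_add:
  assumes "X \<in> L2 M" "Y \<in> L2 M"
  shows "(\<lambda>\<omega>. X \<omega> + Y \<omega>) \<in> L2 M"
  using assms L2_integrable_mult[OF assms]
  by (auto simp: L2_def power2_sum mult.assoc intro: borel_measurable_add)

lemma L2_scale: "X \<in> L2 M \<Longrightarrow> (\<lambda>\<omega>. c * X \<omega>) \<in> L2 M"
  by (auto simp: L2_def power_mult_distrib intro: borel_measurable_times)

lemma L2_diff:
  assumes "X \<in> L2 M" "Y \<in> L2 M"
  shows "(\<lambda>\<omega>. X \<omega> - Y \<omega>) \<in> L2 M"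
  using L2_add[OF assms(1) L2_scale[OF assms(2), of "-1"]] by simp

lemma L2_divide: "X \<in> L2 M \<Longrightarrow> (\<lambda>\<omega>. X \<omega> / c) \<in> L2 M"
  using L2_scale[of X M "1 / c"] by simp

lemma L2_sum:
  assumes "\<And>i. i \<in> I \<Longrightarrow> X i \<in> L2 M"
  shows "(\<lambda>\<omega>. \<Sum>i\<in>I. X i \<omega>) \<in> L2 M"
  using assms
proof (induction I rule: infinite_finite_induct)
  case (insert i I)
  then show ?case using L2_add[of "X i" M "\<lambda>\<omega>. \<Sum>i\<in>I. X i \<omega>"] by simp
qed (simp_all add: L2_def)

lemma (in prob_space) L2_const: "(\<lambda>\<omega>. c) \<in> L2 M"
  by (simp add: L2_def)

text \<open>
  This places the values of a Gaussian field in the Hilbert space; the degenerate case is that of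
  constants.
\<close>
lemma (in prob_space) gaussian_rv_L2:
  assumes "gaussian_rv M X"
  shows "X \<in> L2 M"
proof -
  have X: "X \<in> borel_measurable M" using assms by (simp add: gaussian_rv_def)
  consider \<mu> \<sigma> where "0 < \<sigma>" "distributed M lborel X (normal_density \<mu> \<sigma>)"
    | \<mu> where "AE \<omega> in M. X \<omega> = \<mu>"
    using assms by (auto simp: gaussian_rv_def)
  then have "integrable M (\<lambda>\<omega>. (X \<omega>)\<^sup>2)"
  proof cases
    case (1 \<mu> \<sigma>)
    have "integrable M (\<lambda>\<omega>. (X \<omega> - \<mu>)\<^sup>2)"
      using distributed_integrable[OF 1(2), of "\<lambda>x. (x - \<mu>)\<^sup>2"]
        integrable_normal_moment[OF 1(1), of \<mu> 2] by simp
    then have "(\<lambda>\<omega>. X \<omega> - \<mu>) \<in> L2 M" using X by (simp add: L2_def)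
    from L2_add[OF this L2_const[of \<mu>]] show ?thesis by (simp add: L2_def)
  next
    case (2 \<mu>)
    have "integrable M (\<lambda>\<omega>. (X \<omega>)\<^sup>2) \<longleftrightarrow> integrable M (\<lambda>\<omega>. \<mu>\<^sup>2)"
      using 2 X by (intro integrable_cong_AE) auto
    then show ?thesis by simp
  qed
  then show ?thesis using X by (simp add: L2_def)
qed

text \<open>
  The quadratic polynomial \<open>t \<mapsto> E (X - t Y)\<^sup>2\<close> is nonnegative; its nonnegativity at
  \<open>t = E (X Y) / E Y\<^sup>2\<close> is the claim.
\<close>
lemma Cauchy_Schwarz_L2:
  assumes X: "X \<in> L2 M" and Y: "Y \<in> L2 M"
  shows "(\<integral>\<omega>. X \<omega> * Y \<omega> \<partial>M)\<^sup>2 \<le> (\<integral>\<omega>. (X \<omega>)\<^sup>2 \<partial>M) * (\<integral>\<omega>. (Y \<omega>)\<^sup>2 \<partial>M)"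
proof -
  define A B C where "A = (\<integral>\<omega>. (X \<omega>)\<^sup>2 \<partial>M)" and "B = (\<integral>\<omega>. X \<omega> * Y \<omega> \<partial>M)"
    and "C = (\<integral>\<omega>. (Y \<omega>)\<^sup>2 \<partial>M)"
  note int = L2_integrable_square[OF X] L2_integrable_square[OF Y] L2_integrable_mult[OF X Y]
  have quad: "0 \<le> A - 2 * t * B + t\<^sup>2 * C" for t
  proof -
    have "0 \<le> (\<integral>\<omega>. (X \<omega> - t * Y \<omega>)\<^sup>2 \<partial>M)"
      by (intro integral_nonneg_AE) simp
    also have "(\<lambda>\<omega>. (X \<omega> - t * Y \<omega>)\<^sup>2)
        = (\<lambda>\<omega>. (X \<omega>)\<^sup>2 - (2 * t) * (X \<omega> * Y \<omega>) + t\<^sup>2 * (Y \<omega>)\<^sup>2)"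
      by (simp add: fun_eq_iff power2_eq_square algebra_simps)
    also have "(\<integral>\<omega>. (X \<omega>)\<^sup>2 - (2 * t) * (X \<omega> * Y \<omega>) + t\<^sup>2 * (Y \<omega>)\<^sup>2 \<partial>M)
        = A - 2 * t * B + t\<^sup>2 * C"
      using int unfolding A_def B_def C_def by simp
    finally show ?thesis .
  qed
  have "0 \<le> C" unfolding C_def by (intro integral_nonneg_AE) simp
  have "B\<^sup>2 \<le> A * C"
  proof (cases "C = 0")
    case True
    have "B = 0"
    proof (rule ccontr)
      assume "B \<noteq> 0"
      \<comment> \<open>The polynomial is now affine; at this \<open>t\<close> it would be \<open>-1\<close>.\<close>
      then show False using quad[of "(A + 1) / (2 * B)"] True by simp
    qed
    then show ?thesis using True by simp
  next
    case False
    then have "0 < C" using \<open>0 \<le> C\<close> by simp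
    then have "0 \<le> (A - 2 * (B / C) * B + (B / C)\<^sup>2 * C) * C"
      using quad[of "B / C"] by simp
    also have "\<dots> = A * C - B\<^sup>2"
      using False by (simp add: field_simps power2_eq_square)
    finally show ?thesis by simp
  qed
  then show ?thesis unfolding A_def B_def C_def .
qed

lemma expectation_mult_sum:
  assumes Z: "Z \<in> L2 M" and X: "\<And>i. i \<in> I \<Longrightarrow> X i \<in> L2 M"
  shows "(\<integral>\<omega>. Z \<omega> * (\<Sum>i\<in>I. c i * X i \<omega>) \<partial>M) = (\<Sum>i\<in>I. c i * (\<integral>\<omega>. Z \<omega> * X i \<omega> \<partial>M))"
proof -
  have "(\<lambda>\<omega>. Z \<omega> * (\<Sum>i\<in>I. c i * X i \<omega>)) = (\<lambda>\<omega>. \<Sum>i\<in>I. c i * (Z \<omega> * X i \<omega>))"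
    by (simp add: sum_distrib_left mult_ac)
  then show ?thesis
    using L2_integrable_mult[OF Z X] by simp
qed

lemma expectation_mult_add:
  assumes "Z \<in> L2 M" "X \<in> L2 M" "Y \<in> L2 M"
  shows "(\<integral>\<omega>. Z \<omega> * (X \<omega> + Y \<omega>) \<partial>M) = (\<integral>\<omega>. Z \<omega> * X \<omega> \<partial>M) + (\<integral>\<omega>. Z \<omega> * Y \<omega> \<partial>M)"
  using L2_integrable_mult[OF assms(1,2)] L2_integrable_mult[OF assms(1,3)]
  by (simp add: distrib_left)

lemma expectation_mult_diff:
  assumes "Z \<in> L2 M" "X \<in> L2 M" "Y \<in> L2 M"
  shows "(\<integral>\<omega>. Z \<omega> * (X \<omega> - Y \<omega>) \<partial>M) = (\<integral>\<omega>. Z \<omega> * X \<omega> \<partial>M) - (\<integral>\<omega>. Z \<omega> * Y \<omega> \<partial>M)"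
  using L2_integrable_mult[OF assms(1,2)] L2_integrable_mult[OF assms(1,3)]
  by (simp add: right_diff_distrib)

lemma nn_integral_L2:
  "X \<in> L2 M \<Longrightarrow> (\<integral>\<^sup>+\<omega>. ennreal ((X \<omega>)\<^sup>2) \<partial>M) = ennreal (\<integral>\<omega>. (X \<omega>)\<^sup>2 \<partial>M)"
  by (intro nn_integral_eq_integral) (auto simp: L2_def)

lemma L2_square_add_le:
  assumes X: "X \<in> L2 M" and Y: "Y \<in> L2 M"
  shows "(\<integral>\<omega>. (X \<omega> + Y \<omega>)\<^sup>2 \<partial>M) \<le> 2 * (\<integral>\<omega>. (X \<omega>)\<^sup>2 \<partial>M) + 2 * (\<integral>\<omega>. (Y \<omega>)\<^sup>2 \<partial>M)"
proof -
  have "(\<integral>\<omega>. (X \<omega> + Y \<omega>)\<^sup>2 \<partial>M) \<le> (\<integral>\<omega>. 2 * (X \<omega>)\<^sup>2 + 2 * (Y \<omega>)\<^sup>2 \<partial>M)"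
  proof (rule integral_mono)
    show "integrable M (\<lambda>\<omega>. (X \<omega> + Y \<omega>)\<^sup>2)"
      using L2_integrable_square[OF L2_add[OF X Y]] .
    show "(X \<omega> + Y \<omega>)\<^sup>2 \<le> 2 * (X \<omega>)\<^sup>2 + 2 * (Y \<omega>)\<^sup>2" for \<omega>
      using sum_squares_bound[of "X \<omega>" "Y \<omega>"] by (simp add: power2_sum)
  qed (use L2_integrable_square[OF X] L2_integrable_square[OF Y] in simp)
  then show ?thesis
    using L2_integrable_square[OF X] L2_integrable_square[OF Y] by simp
qed

text \<open>
  A subsequence converges almost everywhere, and Fatou's lemma along it bounds the distance
  of each term to the pointwise limit by its distance to the late terms of the sequence.
\<close>
lemma (in prob_space) L2_complete:
  fixes X :: "nat \<Rightarrow> 'a \<Rightarrow> real"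
  assumes X: "\<And>n. X n \<in> L2 M"
    and Cauchy: "\<And>\<epsilon>. \<epsilon> > 0 \<Longrightarrow> \<exists>N. \<forall>m\<ge>N. \<forall>n\<ge>N. (\<integral>\<omega>. (X m \<omega> - X n \<omega>)\<^sup>2 \<partial>M) < \<epsilon>"
  obtains Y where "Y \<in> L2 M" "(\<lambda>n. \<integral>\<omega>. (X n \<omega> - Y \<omega>)\<^sup>2 \<partial>M) \<longlonglongrightarrow> 0"
proof -
  note meas [measurable] = L2_measurable[OF X]
  have int: "integrable M (X n)" for n
    using L2_integrable_mult[OF X L2_const[of 1]] by simp
  \<comment> \<open>On a probability space the mean of |Z| is at most the root of the mean of Z squared, so the
    sequence is also Cauchy in mean, and a subsequence converges almost everywhere.\<close>
  have "\<exists>N. \<forall>m\<ge>N. \<forall>n\<ge>N. (\<integral>\<omega>. norm (X m \<omega> - X n \<omega>) \<partial>M) < \<epsilon>" if "\<epsilon> > 0" for \<epsilon>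
  proof -
    obtain N where N: "\<And>m n. m \<ge> N \<Longrightarrow> n \<ge> N \<Longrightarrow> (\<integral>\<omega>. (X m \<omega> - X n \<omega>)\<^sup>2 \<partial>M) < \<epsilon>\<^sup>2"
      using Cauchy[of "\<epsilon>\<^sup>2"] \<open>\<epsilon> > 0\<close> by auto
    have "(\<integral>\<omega>. norm (X m \<omega> - X n \<omega>) \<partial>M) < \<epsilon>" if "m \<ge> N" "n \<ge> N" for m n
    proof -
      have "(\<lambda>\<omega>. \<bar>X m \<omega> - X n \<omega>\<bar>) \<in> L2 M"
        using L2_diff[OF X X, of m n] by (simp add: L2_def)
      from Cauchy_Schwarz_L2[OF this L2_const[of 1]] N[OF that]
      have "(\<integral>\<omega>. \<bar>X m \<omega> - X n \<omega>\<bar> \<partial>M)\<^sup>2 < \<epsilon>\<^sup>2"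
        by (simp add: prob_space)
      then show ?thesis
        using \<open>\<epsilon> > 0\<close> by (simp add: power2_less_imp_less)
    qed
    then show ?thesis by blast
  qed
  from cauchy_L1_AE_cauchy_subseq[OF int this]
  obtain r where r: "strict_mono r" "AE \<omega> in M. Cauchy (\<lambda>i. X (r i) \<omega>)"
    by blast
  define Y where "Y \<omega> = lim (\<lambda>i. X (r i) \<omega>)" for \<omega>
  have [measurable]: "Y \<in> borel_measurable M"
    unfolding Y_def by measurable
  have lim: "AE \<omega> in M. (\<lambda>i. X (r i) \<omega>) \<longlonglongrightarrow> Y \<omega>"
    using r(2) unfolding Y_def
    by eventually_elim (simp add: Cauchy_convergent convergent_LIMSEQ_iff[symmetric])
  have Fatou: "(\<integral>\<^sup>+\<omega>. ennreal ((X n \<omega> - Y \<omega>)\<^sup>2) \<partial>M) \<le> ennreal \<epsilon>"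
    if n: "\<And>m. m \<ge> N \<Longrightarrow> (\<integral>\<omega>. (X n \<omega> - X m \<omega>)\<^sup>2 \<partial>M) < \<epsilon>" for n N \<epsilon>
  proof -
    have "(\<integral>\<^sup>+\<omega>. ennreal ((X n \<omega> - Y \<omega>)\<^sup>2) \<partial>M)
        = (\<integral>\<^sup>+\<omega>. liminf (\<lambda>i. ennreal ((X n \<omega> - X (r i) \<omega>)\<^sup>2)) \<partial>M)"
    proof (rule nn_integral_cong_AE)
      show "AE \<omega> in M. ennreal ((X n \<omega> - Y \<omega>)\<^sup>2)
          = liminf (\<lambda>i. ennreal ((X n \<omega> - X (r i) \<omega>)\<^sup>2))"
        using lim
      proof eventually_elim
        case (elim \<omega>)
        then have "(\<lambda>i. ennreal ((X n \<omega> - X (r i) \<omega>)\<^sup>2)) \<longlonglongrightarrow> ennreal ((X n \<omega> - Y \<omega>)\<^sup>2)"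
          by (intro tendsto_intros)
        then show ?case
          by (rule lim_imp_Liminf[OF sequentially_bot, symmetric])
      qed
    qed
    also have "\<dots> \<le> liminf (\<lambda>i. \<integral>\<^sup>+\<omega>. ennreal ((X n \<omega> - X (r i) \<omega>)\<^sup>2) \<partial>M)"
      by (rule nn_integral_liminf) measurable
    also have "\<dots> \<le> liminf (\<lambda>i. ennreal \<epsilon>)"
    proof (rule Liminf_mono)
      show "\<forall>\<^sub>F i in sequentially. (\<integral>\<^sup>+\<omega>. ennreal ((X n \<omega> - X (r i) \<omega>)\<^sup>2) \<partial>M) \<le> ennreal \<epsilon>"
        using eventually_ge_at_top[of N]
      proof eventually_elim
        case (elim i)
        have "r i \<ge> N" using seq_suble[OF r(1), of i] elim by simp
        then show ?case
          using n[of "r i"] by (simp add: nn_integral_L2[OF L2_diff[OF X X]] ennreal_leI)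
      qed
    qed
    also have "\<dots> = ennreal \<epsilon>" by (simp add: Liminf_const)
    finally show ?thesis .
  qed
  have diff: "(\<lambda>\<omega>. X n \<omega> - Y \<omega>) \<in> L2 M" if "(\<integral>\<^sup>+\<omega>. ennreal ((X n \<omega> - Y \<omega>)\<^sup>2) \<partial>M) \<le> ennreal \<epsilon>"
    for n \<epsilon>
    using that by (auto simp: L2_def integrable_iff_bounded intro: le_less_trans)
  obtain N where "\<And>m. m \<ge> N \<Longrightarrow> (\<integral>\<omega>. (X N \<omega> - X m \<omega>)\<^sup>2 \<partial>M) < 1"
    using Cauchy[of 1] by auto
  from L2_diff[OF X[of N] diff[OF Fatou[OF this]]] have Y: "Y \<in> L2 M" by simp
  have "(\<lambda>n. \<integral>\<omega>. (X n \<omega> - Y \<omega>)\<^sup>2 \<partial>M) \<longlonglongrightarrow> 0"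
  proof (rule LIMSEQ_I)
    fix \<epsilon> :: real assume "0 < \<epsilon>"
    then obtain N where N: "\<And>m n. m \<ge> N \<Longrightarrow> n \<ge> N \<Longrightarrow> (\<integral>\<omega>. (X m \<omega> - X n \<omega>)\<^sup>2 \<partial>M) < \<epsilon> / 2"
      using Cauchy[of "\<epsilon> / 2"] by auto
    have "(\<integral>\<omega>. (X n \<omega> - Y \<omega>)\<^sup>2 \<partial>M) < \<epsilon>" if "n \<ge> N" for n
    proof -
      have "(\<integral>\<^sup>+\<omega>. ennreal ((X n \<omega> - Y \<omega>)\<^sup>2) \<partial>M) \<le> ennreal (\<epsilon> / 2)"
        using N[OF that] by (rule Fatou)
      then show ?thesis
        using \<open>0 < \<epsilon>\<close> by (simp add: nn_integral_L2[OF L2_diff[OF X Y]])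
    qed
    then show "\<exists>N. \<forall>n\<ge>N. norm ((\<integral>\<omega>. (X n \<omega> - Y \<omega>)\<^sup>2 \<partial>M) - 0) < \<epsilon>"
      by (intro exI[of _ N]) (simp add: integral_nonneg_AE)
  qed
  then show ?thesis using that Y by blast
qed

section \<open>Mean-square derivatives and inner products\<close>

text \<open>
  For square-integrable fields the nonnegative integral in the definition is finite and can be
  replaced by a real-valued one.
\<close>
lemma has_ms_derivative_iff_L2:
  assumes F: "\<And>b. F b \<in> L2 M"
  shows "has_ms_derivative M F e x Y \<longleftrightarrow> Y \<in> L2 M \<and>
    ((\<lambda>t. \<integral>\<omega>. ((F (x + t *\<^sub>R e) \<omega> - F x \<omega>) / t - Y \<omega>)\<^sup>2 \<partial>M) \<longlongrightarrow> 0) (at 0)"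
proof -
  have *: "(\<integral>\<^sup>+\<omega>. ennreal (((F (x + t *\<^sub>R e) \<omega> - F x \<omega>) / t - Y \<omega>)\<^sup>2) \<partial>M)
      = ennreal (\<integral>\<omega>. ((F (x + t *\<^sub>R e) \<omega> - F x \<omega>) / t - Y \<omega>)\<^sup>2 \<partial>M)" if "Y \<in> L2 M" for t
    using that by (intro nn_integral_L2 L2_diff L2_divide F)
  show ?thesis
  proof (cases "Y \<in> L2 M")
    case True
    then show ?thesis
      unfolding has_ms_derivative_def *[OF True] L2_def mem_Collect_eq
      using tendsto_ennreal_iff[of
          "\<lambda>t. \<integral>\<omega>. ((F (x + t *\<^sub>R e) \<omega> - F x \<omega>) / t - Y \<omega>)\<^sup>2 \<partial>M" "at 0" 0]
      by (auto simp: integral_nonneg_AE)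
  next
    case False
    then show ?thesis by (auto simp: has_ms_derivative_def L2_def)
  qed
qed

lemma has_ms_derivative_L2:
  "has_ms_derivative M F e x Y \<Longrightarrow> Y \<in> L2 M"
  by (simp add: has_ms_derivative_def L2_def)

text \<open>
  Differentiation in mean square is a limit in norm, and by the Cauchy-Schwarz inequality the
  inner product with a fixed \<open>Z\<close> is continuous for it.
\<close>
lemma has_real_derivative_expectation_mult:
  assumes F: "\<And>b. F b \<in> L2 M" and Z: "Z \<in> L2 M" and Y: "has_ms_derivative M F e x Y"
  shows "((\<lambda>t. \<integral>\<omega>. Z \<omega> * F (x + t *\<^sub>R e) \<omega> \<partial>M)
    has_real_derivative (\<integral>\<omega>. Z \<omega> * Y \<omega> \<partial>M)) (at 0)"
proof -
  define R where "R t \<omega> = (F (x + t *\<^sub>R e) \<omega> - F x \<omega>) / t - Y \<omega>" for t \<omega>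
  have YL: "Y \<in> L2 M" and lim: "((\<lambda>t. \<integral>\<omega>. (R t \<omega>)\<^sup>2 \<partial>M) \<longlongrightarrow> 0) (at 0)"
    using Y unfolding has_ms_derivative_iff_L2[OF F] R_def by auto
  have RL: "R t \<in> L2 M" for t
    unfolding R_def by (intro L2_diff L2_divide F YL)
  have bound: "\<bar>\<integral>\<omega>. Z \<omega> * R t \<omega> \<partial>M\<bar> \<le> sqrt ((\<integral>\<omega>. (Z \<omega>)\<^sup>2 \<partial>M) * (\<integral>\<omega>. (R t \<omega>)\<^sup>2 \<partial>M))" for t
    using real_sqrt_le_mono[OF Cauchy_Schwarz_L2[OF Z RL, of t]] by simp
  have "((\<lambda>t. sqrt ((\<integral>\<omega>. (Z \<omega>)\<^sup>2 \<partial>M) * (\<integral>\<omega>. (R t \<omega>)\<^sup>2 \<partial>M))) \<longlongrightarrow> 0) (at 0)"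
    using tendsto_real_sqrt[OF tendsto_mult_right_zero[OF lim]] by simp
  then have *: "((\<lambda>t. \<integral>\<omega>. Z \<omega> * R t \<omega> \<partial>M) \<longlongrightarrow> 0) (at 0)"
    by (rule Lim_null_comparison[rotated]) (simp add: bound)
  have eq: "(\<integral>\<omega>. Z \<omega> * R t \<omega> \<partial>M)
      = ((\<integral>\<omega>. Z \<omega> * F (x + t *\<^sub>R e) \<omega> \<partial>M) - (\<integral>\<omega>. Z \<omega> * F x \<omega> \<partial>M)) / t - (\<integral>\<omega>. Z \<omega> * Y \<omega> \<partial>M)"
    for t
  proof -
    have "(\<lambda>\<omega>. Z \<omega> * R t \<omega>)
        = (\<lambda>\<omega>. (Z \<omega> * F (x + t *\<^sub>R e) \<omega> - Z \<omega> * F x \<omega>) / t - Z \<omega> * Y \<omega>)"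
      by (simp add: fun_eq_iff R_def algebra_simps diff_divide_distrib)
    then show ?thesis
      using L2_integrable_mult[OF Z F] L2_integrable_mult[OF Z YL] by simp
  qed
  show ?thesis
    using * unfolding eq DERIV_def by (simp add: LIM_zero_iff)
qed

section \<open>Calculus of smooth kernels\<close>

lemma MVT_from_zero:
  fixes f :: "real \<Rightarrow> real"
  assumes f: "\<And>t. (f has_real_derivative f' t) (at t)"
  obtains \<theta> where "\<bar>\<theta>\<bar> \<le> \<bar>s\<bar>" "f s - f 0 = s * f' \<theta>"
proof (cases s "0 :: real" rule: linorder_cases)
  case less
  from MVT2[OF less, of f f'] f obtain z where "s < z" "z < 0" "f 0 - f s = (0 - s) * f' z"
    by blast
  then show ?thesis using that[of z] by simp
next
  case greater
  from MVT2[OF greater, of f f'] f obtain z where "0 < z" "z < s" "f s - f 0 = (s - 0) * f' z"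
    by blast
  then show ?thesis using that[of z] by simp
qed (use that[of 0] in simp)

lemma line_derivative_shift:
  fixes f f' :: "'a::real_vector \<Rightarrow> real"
  assumes "\<And>a. ((\<lambda>t. f (a + t *\<^sub>R e)) has_real_derivative f' a) (at 0)"
  shows "((\<lambda>t. f (a + t *\<^sub>R e)) has_real_derivative f' (a + s *\<^sub>R e)) (at s)"
proof -
  have "(\<lambda>t. f (a + (t + s) *\<^sub>R e)) = (\<lambda>t. f ((a + s *\<^sub>R e) + t *\<^sub>R e))"
    by (simp add: scaleR_add_left add_ac)
  then show ?thesis
    using assms[of "a + s *\<^sub>R e"] DERIV_shift[of "\<lambda>t. f (a + t *\<^sub>R e)" _ 0 s] by simp
qed

text \<open>
  Applying the mean value theorem in each slot turns the mixed difference quotient into a value of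
  the mixed derivative at a nearby point. Continuity then makes the convergence joint in both
  increments, as the Cauchy criterion below requires.
\<close>
lemma mixed_difference_quotient:
  fixes K K' L :: "'a::real_normed_vector \<times> 'a \<Rightarrow> real"
  assumes K: "\<And>a b. ((\<lambda>s. K (a + s *\<^sub>R e, b)) has_real_derivative K' (a, b)) (at 0)"
    and K': "\<And>a b. ((\<lambda>t. K' (a, b + t *\<^sub>R e)) has_real_derivative L (a, b)) (at 0)"
    and L: "continuous_on UNIV L"
    and "0 < \<epsilon>"
  obtains \<delta> where "0 < \<delta>"
    and "\<And>s t. s \<noteq> 0 \<Longrightarrow> t \<noteq> 0 \<Longrightarrow> \<bar>s\<bar> < \<delta> \<Longrightarrow> \<bar>t\<bar> < \<delta> \<Longrightarrow>
      \<bar>(K (x + s *\<^sub>R e, x + t *\<^sub>R e) - K (x + s *\<^sub>R e, x) - K (x, x + t *\<^sub>R e) + K (x, x)) / (s * t)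
        - L (x, x)\<bar> < \<epsilon>"
proof -
  have "isCont (\<lambda>(s, t). L (x + s *\<^sub>R e, x + t *\<^sub>R e)) (0 :: real, 0 :: real)"
  proof -
    have "continuous_on UNIV (\<lambda>p :: real \<times> real. L (x + fst p *\<^sub>R e, x + snd p *\<^sub>R e))"
      by (rule continuous_on_compose2[OF L]) (intro continuous_intros, simp)
    then show ?thesis
      unfolding continuous_on_eq_continuous_at[OF open_UNIV] case_prod_beta by blast
  qed
  then obtain d where "d > 0" and d: "\<And>p. dist p (0, 0) < d \<Longrightarrow>
      dist ((\<lambda>(s, t). L (x + s *\<^sub>R e, x + t *\<^sub>R e)) p) (L (x, x)) < \<epsilon>"
    using \<open>0 < \<epsilon>\<close> unfolding continuous_at_eps_delta by fastforce
  show ?thesis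
  proof (rule that[of "d / 2"])
    fix s t :: real
    assume st: "s \<noteq> 0" "t \<noteq> 0" "\<bar>s\<bar> < d / 2" "\<bar>t\<bar> < d / 2"
    have "((\<lambda>s. K (x + s *\<^sub>R e, x + t *\<^sub>R e) - K (x + s *\<^sub>R e, x)) has_real_derivative
        K' (x + \<sigma> *\<^sub>R e, x + t *\<^sub>R e) - K' (x + \<sigma> *\<^sub>R e, x)) (at \<sigma>)" for \<sigma>
      using line_derivative_shift[where f = "\<lambda>a. K (a, x + t *\<^sub>R e)" and f' = "\<lambda>a. K' (a, x + t *\<^sub>R e)", OF K]
        line_derivative_shift[where f = "\<lambda>a. K (a, x)" and f' = "\<lambda>a. K' (a, x)", OF K]
      by (intro DERIV_diff)
    then obtain \<sigma> where \<sigma>: "\<bar>\<sigma>\<bar> \<le> \<bar>s\<bar>"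
      and 1: "K (x + s *\<^sub>R e, x + t *\<^sub>R e) - K (x + s *\<^sub>R e, x)
          - (K (x + 0 *\<^sub>R e, x + t *\<^sub>R e) - K (x + 0 *\<^sub>R e, x))
        = s * (K' (x + \<sigma> *\<^sub>R e, x + t *\<^sub>R e) - K' (x + \<sigma> *\<^sub>R e, x))"
      by (rule MVT_from_zero)
    have "((\<lambda>t. K' (x + \<sigma> *\<^sub>R e, x + t *\<^sub>R e)) has_real_derivative
        L (x + \<sigma> *\<^sub>R e, x + \<tau> *\<^sub>R e)) (at \<tau>)" for \<tau>
      using line_derivative_shift[where f = "\<lambda>b. K' (x + \<sigma> *\<^sub>R e, b)"
          and f' = "\<lambda>b. L (x + \<sigma> *\<^sub>R e, b)", OF K'] .
    then obtain \<tau> where \<tau>: "\<bar>\<tau>\<bar> \<le> \<bar>t\<bar>"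
      and 2: "K' (x + \<sigma> *\<^sub>R e, x + t *\<^sub>R e) - K' (x + \<sigma> *\<^sub>R e, x + 0 *\<^sub>R e)
        = t * L (x + \<sigma> *\<^sub>R e, x + \<tau> *\<^sub>R e)"
      by (rule MVT_from_zero)
    have "dist (\<sigma>, \<tau>) (0, 0) \<le> \<bar>\<sigma>\<bar> + \<bar>\<tau>\<bar>"
      by (simp add: dist_Pair_Pair sqrt_sum_squares_le_sum_abs)
    then have "dist (\<sigma>, \<tau>) (0, 0) < d"
      using \<sigma> \<tau> st by linarith
    then have "\<bar>L (x + \<sigma> *\<^sub>R e, x + \<tau> *\<^sub>R e) - L (x, x)\<bar> < \<epsilon>"
      using d[of "(\<sigma>, \<tau>)"] by (simp add: dist_real_def)
    moreover have "K (x + s *\<^sub>R e, x + t *\<^sub>R e) - K (x + s *\<^sub>R e, x) - K (x, x + t *\<^sub>R e) + K (x, x)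
        = (s * t) * L (x + \<sigma> *\<^sub>R e, x + \<tau> *\<^sub>R e)"
      using 1 2 by (simp add: algebra_simps)
    ultimately show "\<bar>(K (x + s *\<^sub>R e, x + t *\<^sub>R e) - K (x + s *\<^sub>R e, x) - K (x, x + t *\<^sub>R e) + K (x, x)) / (s * t)
        - L (x, x)\<bar> < \<epsilon>"
      using st by simp
  qed (use \<open>d > 0\<close> in simp)
qed

text \<open>
  L'Hopital's rule once: the second derivative is only assumed to exist at 0, so the last step is
  its definition.
\<close>
lemma second_order_Peano:
  fixes \<psi> \<psi>' :: "real \<Rightarrow> real"
  assumes \<psi>: "\<And>s. (\<psi> has_real_derivative \<psi>' s) (at s)"
    and \<psi>': "(\<psi>' has_real_derivative c) (at 0)"
  shows "((\<lambda>s. (\<psi> s - \<psi> 0 - s * \<psi>' 0) / s\<^sup>2) \<longlongrightarrow> c / 2) (at 0)"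
proof (rule lhopital)
  have cont: "(\<psi> \<longlongrightarrow> \<psi> 0) (at 0)"
    using DERIV_isCont[OF \<psi>] by (simp add: isCont_def)
  show "((\<lambda>s. \<psi> s - \<psi> 0 - s * \<psi>' 0) \<longlongrightarrow> 0) (at 0)"
    using tendsto_diff[OF LIM_zero[OF cont] tendsto_mult_left_zero[OF tendsto_ident_at]] by simp
  show "((\<lambda>s :: real. s\<^sup>2) \<longlongrightarrow> 0) (at 0)"
    using tendsto_power[OF tendsto_ident_at[of "0 :: real" UNIV], of 2] by simp
  show "\<forall>\<^sub>F s :: real in at 0. s\<^sup>2 \<noteq> 0" "\<forall>\<^sub>F s :: real in at 0. 2 * s \<noteq> 0"
    by (auto simp: eventually_at_filter)
  show "\<forall>\<^sub>F s in at 0. ((\<lambda>s. \<psi> s - \<psi> 0 - s * \<psi>' 0) has_real_derivative \<psi>' s - \<psi>' 0) (at s)"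
    by (intro always_eventually allI) (auto intro!: derivative_eq_intros \<psi>)
  show "\<forall>\<^sub>F s in at 0. ((\<lambda>s. s\<^sup>2) has_real_derivative 2 * s) (at s)"
    by (intro always_eventually allI) (auto intro!: derivative_eq_intros)
  have "((\<lambda>s. (\<psi>' s - \<psi>' 0) / s / 2) \<longlongrightarrow> c / 2) (at 0)"
    using \<psi>' unfolding DERIV_def by (intro tendsto_intros) (simp_all add: tendsto_divide)
  then show "((\<lambda>s. (\<psi>' s - \<psi>' 0) / (2 * s)) \<longlongrightarrow> c / 2) (at 0)"
    by (simp add: mult.commute)
qed

text \<open>
  The squared norm never leaves the half-line, so the chain rule applies to a derivative relative to
  the half-line, also at \<open>a = b\<close>, where that derivative is one-sided.
\<close>
lemma has_real_derivative_norm_square_line: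
  fixes a b e :: "'a::real_inner"
  assumes h: "(h has_real_derivative d) (at ((norm (a - b))\<^sup>2) within {0..})"
  shows "((\<lambda>t. h ((norm (a + t *\<^sub>R e - b))\<^sup>2)) has_real_derivative 2 * d * ((a - b) \<bullet> e)) (at 0)"
proof -
  let ?g = "\<lambda>t. (norm (a + t *\<^sub>R e - b))\<^sup>2"
  have g: "?g = (\<lambda>t. (norm (a - b))\<^sup>2 + 2 * t * ((a - b) \<bullet> e) + t\<^sup>2 * (e \<bullet> e))"
  proof
    fix t
    have "a + t *\<^sub>R e - b = (a - b) + t *\<^sub>R e" by simp
    then have "?g t = ((a - b) + t *\<^sub>R e) \<bullet> ((a - b) + t *\<^sub>R e)"
      by (simp only: power2_norm_eq_inner)
    also have "\<dots> = (a - b) \<bullet> (a - b) + 2 * t * ((a - b) \<bullet> e) + t\<^sup>2 * (e \<bullet> e)"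
      unfolding inner_add_left inner_add_right inner_scaleR_left inner_scaleR_right
        inner_commute[of e "a - b"] by (simp add: power2_eq_square algebra_simps)
    finally show "?g t = (norm (a - b))\<^sup>2 + 2 * t * ((a - b) \<bullet> e) + t\<^sup>2 * (e \<bullet> e)"
      by (simp only: power2_norm_eq_inner)
  qed
  have "(?g has_real_derivative 2 * ((a - b) \<bullet> e)) (at 0)"
    unfolding g by (auto intro!: derivative_eq_intros)
  moreover have "(h has_real_derivative d) (at (?g 0) within range ?g)"
    using h by (auto intro: DERIV_subset)
  ultimately have "(h \<circ> ?g has_real_derivative d * (2 * ((a - b) \<bullet> e))) (at 0)"
    by (intro DERIV_image_chain)
  then show ?thesis by (simp add: o_def mult_ac)
qed

lemma n_times_cont_diff_continuous:
  "n_times_cont_diff n F \<Longrightarrow> continuous_on UNIV F"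
  by (cases n) (auto intro!: differentiable_imp_continuous_on simp: differentiable_on_def
      intro: differentiable_at_withinI)

lemma n_times_cont_diff_line_derivative:
  assumes "n_times_cont_diff (Suc n) F"
  shows "((\<lambda>t. F (a + t *\<^sub>R v)) has_real_derivative frechet_derivative F (at a) v) (at 0)"
proof -
  have "(F has_derivative frechet_derivative F (at a)) (at (a + 0 *\<^sub>R v))"
    using assms by (simp add: frechet_derivative_works[symmetric])
  then have "((\<lambda>t. F (a + t *\<^sub>R v)) has_derivative
      (\<lambda>t. frechet_derivative F (at a) (t *\<^sub>R v))) (at 0)"
    by (rule has_derivative_compose[rotated]) (auto intro!: derivative_eq_intros)
  moreover have "linear (frechet_derivative F (at a))"
    using assms by (simp add: linear_frechet_derivative)
  ultimately show ?thesis
    by (simp add: has_field_derivative_def linear_cmul mult_commute_abs)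
qed

lemma n_times_cont_diff_add:
  "n_times_cont_diff n F \<Longrightarrow> n_times_cont_diff n G \<Longrightarrow> n_times_cont_diff n (\<lambda>x. F x + G x)"
proof (induction n arbitrary: F G)
  case (Suc n)
  have D: "((\<lambda>x. F x + G x) has_derivative
      (\<lambda>v. frechet_derivative F (at x) v + frechet_derivative G (at x) v)) (at x)" for x
    using Suc.prems by (intro has_derivative_add) (simp_all add: frechet_derivative_works[symmetric])
  have "frechet_derivative (\<lambda>x. F x + G x) (at x) v
      = frechet_derivative F (at x) v + frechet_derivative G (at x) v" for x v
    using frechet_derivative_at[OF D, of x] by (metis (no_types))
  then show ?case using Suc by simp
qed (simp add: continuous_on_add)

lemma n_times_cont_diff_minus:
  "n_times_cont_diff n F \<Longrightarrow> n_times_cont_diff n (\<lambda>x. - F x)"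
proof (induction n arbitrary: F)
  case (Suc n)
  have D: "((\<lambda>x. - F x) has_derivative (\<lambda>v. - frechet_derivative F (at x) v)) (at x)" for x
    using Suc.prems by (intro has_derivative_minus) (simp add: frechet_derivative_works[symmetric])
  have "frechet_derivative (\<lambda>x. - F x) (at x) v = - frechet_derivative F (at x) v" for x v
    using frechet_derivative_at[OF D, of x] by (metis (no_types))
  moreover have "(\<lambda>x. - F x) differentiable (at x)" for x
    using D by (auto simp: differentiable_def)
  ultimately show ?case using Suc by simp
qed (simp add: continuous_on_minus)

lemma n_times_cont_diff_diff:
  "n_times_cont_diff n F \<Longrightarrow> n_times_cont_diff n G \<Longrightarrow> n_times_cont_diff n (\<lambda>x. F x - G x)"
  using n_times_cont_diff_add[of n F "\<lambda>x. - G x"] n_times_cont_diff_minus[of n G] by simp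

lemma n_times_cont_diff_compose_linear:
  fixes A :: "'a::euclidean_space \<Rightarrow> 'b::euclidean_space"
  assumes A: "linear A"
  shows "n_times_cont_diff n F \<Longrightarrow> n_times_cont_diff n (\<lambda>x. F (A x))"
proof (induction n arbitrary: F)
  case 0
  then show ?case
    using continuous_on_compose2[of UNIV F UNIV A] linear_continuous_on linear_conv_bounded_linear A
    by auto
next
  case (Suc n)
  have D: "((\<lambda>x. F (A x)) has_derivative (\<lambda>v. frechet_derivative F (at (A x)) (A v))) (at x)" for x
  proof (rule has_derivative_compose[where g = F])
    show "(A has_derivative A) (at x)"
      by (rule linear_imp_has_derivative[OF A])
    show "(F has_derivative frechet_derivative F (at (A x))) (at (A x))"
      using Suc.prems unfolding n_times_cont_diff.simps frechet_derivative_works[symmetric] by blast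
  qed
  have "frechet_derivative (\<lambda>x. F (A x)) (at x) v = frechet_derivative F (at (A x)) (A v)" for x v
    using frechet_derivative_at[OF D, of x] by (metis (no_types))
  moreover have "(\<lambda>x. F (A x)) differentiable (at x)" for x
    using D by (auto simp: differentiable_def)
  moreover have "n_times_cont_diff n (\<lambda>x. frechet_derivative F (at (A x)) (A v))" for v
    using Suc.IH[of "\<lambda>y. frechet_derivative F (at y) (A v)"] Suc.prems by simp
  ultimately show ?case by simp
qed

section \<open>Smooth kernels give mean-square differentiable fields\<close>

definition second_moment_kernel ::
    "'w measure \<Rightarrow> ('a \<Rightarrow> 'w \<Rightarrow> real) \<Rightarrow> ('a \<times> 'a \<Rightarrow> real) \<Rightarrow> bool" where
  "second_moment_kernel M F K \<longleftrightarrow>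
     (\<forall>a. F a \<in> L2 M) \<and> (\<forall>a b. (\<integral>\<omega>. F a \<omega> * F b \<omega> \<partial>M) = K (a, b))"

lemma second_moment_kernel_L2: "second_moment_kernel M F K \<Longrightarrow> F a \<in> L2 M"
  unfolding second_moment_kernel_def by blast

lemma second_moment_kernel_eq:
  "second_moment_kernel M F K \<Longrightarrow> (\<integral>\<omega>. F a \<omega> * F b \<omega> \<partial>M) = K (a, b)"
  unfolding second_moment_kernel_def by blast

definition mixed_derivative ::
    "('a::euclidean_space \<times> 'a \<Rightarrow> real) \<Rightarrow> 'a \<Rightarrow> 'a \<times> 'a \<Rightarrow> real" where
  "mixed_derivative K e p =
     frechet_derivative (\<lambda>q. frechet_derivative K (at q) (e, 0)) (at p) (0, e)"

lemma n_times_cont_diff_mixed_derivative: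
  "n_times_cont_diff (Suc (Suc n)) K \<Longrightarrow> n_times_cont_diff n (mixed_derivative K e)"
  by (simp add: mixed_derivative_def[abs_def])

lemma
  fixes K :: "'a::euclidean_space \<times> 'a \<Rightarrow> real"
  assumes "n_times_cont_diff (Suc (Suc n)) K"
  shows n_times_cont_diff_first_slot:
      "((\<lambda>s. K (a + s *\<^sub>R e, b)) has_real_derivative frechet_derivative K (at (a, b)) (e, 0)) (at 0)"
    and n_times_cont_diff_second_slot:
      "((\<lambda>t. frechet_derivative K (at (a, b + t *\<^sub>R e)) (e, 0)) has_real_derivative
          mixed_derivative K e (a, b)) (at 0)"
  using n_times_cont_diff_line_derivative[OF assms, of "(a, b)" "(e, 0)"]
    n_times_cont_diff_line_derivative[of n "\<lambda>q. frechet_derivative K (at q) (e, 0)" "(a, b)" "(0, e)"]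
    assms
  by (simp_all add: mixed_derivative_def)

text \<open>
  Loeve's criterion. For difference quotients \<open>Q s\<close> and \<open>Q t\<close>,
  \<open>E (Q s - Q t)\<^sup>2 = E (Q s Q s) - 2 E (Q s Q t) + E (Q t Q t)\<close>, and all three terms
  tend to the same mixed derivative of the kernel; so the quotients are Cauchy.
\<close>
lemma (in prob_space) has_ms_derivative_ms_deriv:
  fixes F :: "'c::euclidean_space \<Rightarrow> 'a \<Rightarrow> real"
  assumes F: "second_moment_kernel M F K" and K: "n_times_cont_diff (Suc (Suc n)) K"
  shows "has_ms_derivative M F e x (ms_deriv M F e x)"
proof -
  note FL = second_moment_kernel_L2[OF F] and FK = second_moment_kernel_eq[OF F]
  define Q where "Q t \<omega> = (F (x + t *\<^sub>R e) \<omega> - F x \<omega>) / t" for t \<omega>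
  have QL: "Q t \<in> L2 M" for t
    unfolding Q_def by (intro L2_divide L2_diff FL)
  have EQ: "(\<integral>\<omega>. Q s \<omega> * Q t \<omega> \<partial>M)
      = (K (x + s *\<^sub>R e, x + t *\<^sub>R e) - K (x + s *\<^sub>R e, x) - K (x, x + t *\<^sub>R e) + K (x, x)) / (s * t)"
    for s t
  proof -
    have "(\<lambda>\<omega>. Q s \<omega> * Q t \<omega>)
        = (\<lambda>\<omega>. (F (x + s *\<^sub>R e) \<omega> * F (x + t *\<^sub>R e) \<omega> - F (x + s *\<^sub>R e) \<omega> * F x \<omega>
            - F x \<omega> * F (x + t *\<^sub>R e) \<omega> + F x \<omega> * F x \<omega>) / (s * t))"
      by (simp add: fun_eq_iff Q_def algebra_simps)
    then show ?thesis
      using L2_integrable_mult[OF FL FL] by (simp add: FK)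
  qed
  have sq: "(\<integral>\<omega>. (Q s \<omega> - Q t \<omega>)\<^sup>2 \<partial>M)
      = (\<integral>\<omega>. Q s \<omega> * Q s \<omega> \<partial>M) - 2 * (\<integral>\<omega>. Q s \<omega> * Q t \<omega> \<partial>M) + (\<integral>\<omega>. Q t \<omega> * Q t \<omega> \<partial>M)" for s t
  proof -
    have "(\<lambda>\<omega>. (Q s \<omega> - Q t \<omega>)\<^sup>2) = (\<lambda>\<omega>. Q s \<omega> * Q s \<omega> - 2 * (Q s \<omega> * Q t \<omega>) + Q t \<omega> * Q t \<omega>)"
      by (simp add: fun_eq_iff power2_eq_square algebra_simps)
    then show ?thesis
      using L2_integrable_mult[OF QL QL] by simp
  qed
  have Cauchy: "\<exists>\<delta>>0. \<forall>s t. s \<noteq> 0 \<longrightarrow> t \<noteq> 0 \<longrightarrow> \<bar>s\<bar> < \<delta> \<longrightarrow> \<bar>t\<bar> < \<delta> \<longrightarrow>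
      (\<integral>\<omega>. (Q s \<omega> - Q t \<omega>)\<^sup>2 \<partial>M) < \<epsilon>" if "0 < \<epsilon>" for \<epsilon>
  proof -
    have "0 < \<epsilon> / 4" using that by simp
    from mixed_difference_quotient[OF n_times_cont_diff_first_slot[OF K]
        n_times_cont_diff_second_slot[OF K]
        n_times_cont_diff_continuous[OF n_times_cont_diff_mixed_derivative[OF K]] this]
    obtain \<delta> where "0 < \<delta>"
      and \<delta>: "\<And>s t. s \<noteq> 0 \<Longrightarrow> t \<noteq> 0 \<Longrightarrow> \<bar>s\<bar> < \<delta> \<Longrightarrow> \<bar>t\<bar> < \<delta> \<Longrightarrow>
        \<bar>(\<integral>\<omega>. Q s \<omega> * Q t \<omega> \<partial>M) - mixed_derivative K e (x, x)\<bar> < \<epsilon> / 4"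
      unfolding EQ by blast
    have "(\<integral>\<omega>. (Q s \<omega> - Q t \<omega>)\<^sup>2 \<partial>M) < \<epsilon>"
      if "s \<noteq> 0" "t \<noteq> 0" "\<bar>s\<bar> < \<delta>" "\<bar>t\<bar> < \<delta>" for s t
      using \<delta>[of s s] \<delta>[of s t] \<delta>[of t t] that unfolding sq abs_less_iff by linarith
    then show ?thesis using \<open>0 < \<delta>\<close> by blast
  qed
  \<comment> \<open>Completeness concerns sequences: the limit is taken along one null sequence of increments, and
    the Cauchy property extends it to all increments.\<close>
  define \<tau> where "\<tau> n = inverse (real (Suc n))" for n
  have \<tau>: "\<tau> n \<noteq> 0" for n
    by (simp add: \<tau>_def)
  have \<tau>_lim: "\<tau> \<longlonglongrightarrow> 0"
    using LIMSEQ_inverse_real_of_nat by (simp add: \<tau>_def[abs_def])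
  have small: "\<exists>N. \<forall>n\<ge>N. \<bar>\<tau> n\<bar> < \<delta>" if "0 < \<delta>" for \<delta>
    using LIMSEQ_D[OF \<tau>_lim that] by simp
  have "\<exists>N. \<forall>m\<ge>N. \<forall>n\<ge>N. (\<integral>\<omega>. (Q (\<tau> m) \<omega> - Q (\<tau> n) \<omega>)\<^sup>2 \<partial>M) < \<epsilon>" if "0 < \<epsilon>" for \<epsilon>
    using Cauchy[OF that] small \<tau> by meson
  from L2_complete[OF QL this] obtain Y where YL: "Y \<in> L2 M"
    and Y: "(\<lambda>n. \<integral>\<omega>. (Q (\<tau> n) \<omega> - Y \<omega>)\<^sup>2 \<partial>M) \<longlonglongrightarrow> 0"
    by blast
  have "((\<lambda>t. \<integral>\<omega>. (Q t \<omega> - Y \<omega>)\<^sup>2 \<partial>M) \<longlongrightarrow> 0) (at 0)"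
  proof (rule LIM_I)
    fix \<epsilon> :: real assume "0 < \<epsilon>"
    then have "0 < \<epsilon> / 4" by simp
    from Cauchy[OF this] obtain \<delta> where "0 < \<delta>" and \<delta>: "\<And>s t. s \<noteq> 0 \<Longrightarrow> t \<noteq> 0 \<Longrightarrow>
        \<bar>s\<bar> < \<delta> \<Longrightarrow> \<bar>t\<bar> < \<delta> \<Longrightarrow> (\<integral>\<omega>. (Q s \<omega> - Q t \<omega>)\<^sup>2 \<partial>M) < \<epsilon> / 4"
      by blast
    obtain N\<^sub>1 where N\<^sub>1: "\<And>n. n \<ge> N\<^sub>1 \<Longrightarrow> \<bar>\<tau> n\<bar> < \<delta>"
      using small[OF \<open>0 < \<delta>\<close>] by blast
    obtain N\<^sub>2 where N\<^sub>2: "\<And>n. n \<ge> N\<^sub>2 \<Longrightarrow> \<bar>\<integral>\<omega>. (Q (\<tau> n) \<omega> - Y \<omega>)\<^sup>2 \<partial>M\<bar> < \<epsilon> / 4"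
      using LIMSEQ_D[OF Y \<open>0 < \<epsilon> / 4\<close>] by auto
    define n where "n = max N\<^sub>1 N\<^sub>2"
    have "(\<integral>\<omega>. (Q t \<omega> - Y \<omega>)\<^sup>2 \<partial>M) < \<epsilon>" if "t \<noteq> 0" "\<bar>t\<bar> < \<delta>" for t
      using L2_square_add_le[OF L2_diff[OF QL QL] L2_diff[OF QL YL], of t "\<tau> n" "\<tau> n"]
        \<delta>[OF that(1) \<tau> that(2) N\<^sub>1, of n] N\<^sub>2[of n]
      unfolding n_def by simp
    then show "\<exists>\<delta>>0. \<forall>t. t \<noteq> 0 \<and> norm (t - 0) < \<delta> \<longrightarrow>
        norm ((\<integral>\<omega>. (Q t \<omega> - Y \<omega>)\<^sup>2 \<partial>M) - 0) < \<epsilon>"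
      using \<open>0 < \<delta>\<close> by (intro exI[of _ \<delta>]) (simp add: integral_nonneg_AE)
  qed
  then have "has_ms_derivative M F e x Y"
    unfolding has_ms_derivative_iff_L2[OF FL] Q_def using YL by simp
  then show ?thesis unfolding ms_deriv_def by (rule someI[of "has_ms_derivative M F e x"])
qed

text \<open>
  Each factor is differentiated separately. The new kernel is twice less differentiable, which
  allows the criterion to be applied again to the derived field.
\<close>
lemma (in prob_space) second_moment_kernel_ms_deriv:
  fixes F :: "'c::euclidean_space \<Rightarrow> 'a \<Rightarrow> real"
  assumes F: "second_moment_kernel M F K" and K: "n_times_cont_diff (Suc (Suc n)) K"
  shows "second_moment_kernel M (ms_deriv M F e) (mixed_derivative K e)"
proof -
  note FL = second_moment_kernel_L2[OF F] and FK = second_moment_kernel_eq[OF F]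
  note D = has_ms_derivative_ms_deriv[OF F K]
  have DL: "ms_deriv M F e b \<in> L2 M" for b
    using has_ms_derivative_L2[OF D] .
  have 1: "(\<integral>\<omega>. ms_deriv M F e a \<omega> * F b \<omega> \<partial>M) = frechet_derivative K (at (a, b)) (e, 0)" for a b
  proof (rule DERIV_unique)
    show "((\<lambda>t. K (a + t *\<^sub>R e, b)) has_real_derivative
        (\<integral>\<omega>. ms_deriv M F e a \<omega> * F b \<omega> \<partial>M)) (at 0)"
      using has_real_derivative_expectation_mult[OF FL FL D, of b a e]
      by (simp add: FK mult.commute[of "F b _"])
  qed (rule n_times_cont_diff_first_slot[OF K])
  have "(\<integral>\<omega>. ms_deriv M F e a \<omega> * ms_deriv M F e b \<omega> \<partial>M) = mixed_derivative K e (a, b)" for a b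
  proof (rule DERIV_unique)
    show "((\<lambda>t. frechet_derivative K (at (a, b + t *\<^sub>R e)) (e, 0)) has_real_derivative
        (\<integral>\<omega>. ms_deriv M F e a \<omega> * ms_deriv M F e b \<omega> \<partial>M)) (at 0)"
      using has_real_derivative_expectation_mult[OF FL DL D, of a b e] by (simp add: 1)
  qed (rule n_times_cont_diff_second_slot[OF K])
  then show ?thesis using DL by (simp add: second_moment_kernel_def)
qed

section \<open>The block field and its kernel\<close>

lemma norm_swap: "norm (prod.swap x) = norm x"
  by (cases x) (simp add: norm_Pair add.commute)

lemma swap_diff: "prod.swap (x - y) = prod.swap x - prod.swap y"
  by (simp add: prod_eq_iff)

lemma inner_swap: "prod.swap x \<bullet> y = x \<bullet> prod.swap y"
  by (cases x; cases y) (simp add: add.commute)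

lemma norm_swap_diff: "norm (prod.swap x - y) = norm (x - prod.swap y)"
  using norm_swap[of "x - prod.swap y"] by (simp add: swap_diff)

lemma linear_on_blocks:
  "linear (\<lambda>p. (fst p, prod.swap (snd p)))" "linear (\<lambda>p. (prod.swap (fst p), snd p))"
  "linear (\<lambda>p. (prod.swap (fst p), prod.swap (snd p)))"
  by (auto intro!: linearI simp: prod_eq_iff)

lemma second_moment_kernel_block_field:
  assumes "second_moment_kernel M u K"
  shows "second_moment_kernel M (block_field u) (\<lambda>p. K p - K (fst p, prod.swap (snd p))
      - (K (prod.swap (fst p), snd p) - K (prod.swap (fst p), prod.swap (snd p))))"
proof -
  note L = second_moment_kernel_L2[OF assms] and K = second_moment_kernel_eq[OF assms]
  have "block_field u a \<in> L2 M" for a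
    using L2_diff[OF L L, of a "prod.swap a"] by (simp add: block_field_def[abs_def])
  moreover have "(\<integral>\<omega>. block_field u a \<omega> * block_field u b \<omega> \<partial>M)
      = K (a, b) - K (a, prod.swap b) - (K (prod.swap a, b) - K (prod.swap a, prod.swap b))" for a b
  proof -
    have "(\<lambda>\<omega>. block_field u a \<omega> * block_field u b \<omega>)
        = (\<lambda>\<omega>. u a \<omega> * u b \<omega> - u a \<omega> * u (prod.swap b) \<omega>
            - (u (prod.swap a) \<omega> * u b \<omega> - u (prod.swap a) \<omega> * u (prod.swap b) \<omega>))"
      by (simp add: fun_eq_iff block_field_def algebra_simps)
    then show ?thesis using L2_integrable_mult[OF L L] by (simp add: K)
  qed
  ultimately show ?thesis by (simp add: second_moment_kernel_def)
qed

lemma n_times_cont_diff_block_kernel: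
  assumes "n_times_cont_diff n K"
  shows "n_times_cont_diff n (\<lambda>p. K p - K (fst p, prod.swap (snd p))
      - (K (prod.swap (fst p), snd p) - K (prod.swap (fst p), prod.swap (snd p))))"
  by (intro n_times_cont_diff_diff assms
      n_times_cont_diff_compose_linear[OF linear_on_blocks(1) assms]
      n_times_cont_diff_compose_linear[OF linear_on_blocks(2) assms]
      n_times_cont_diff_compose_linear[OF linear_on_blocks(3) assms])

text \<open>
  The base field enters through its first and second moments. As it is centered, its kernel is its
  covariance function; \<open>second_moment_kernel\<close> also makes its values square-integrable.
\<close>
locale block_isotropic_field = prob_space M
  for M :: "'w measure" +
  fixes u :: "(real^'d::finite) \<times> (real^'d) \<Rightarrow> 'w \<Rightarrow> real"
    and h h' h'' :: "real \<Rightarrow> real"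
    and zs :: "real^'d"
  assumes mean_base: "(\<integral>\<omega>. u a \<omega> \<partial>M) = 0"
    and kernel_base: "second_moment_kernel M u (\<lambda>(a, b). h ((norm (a - b))\<^sup>2))"
    and smooth_base: "n_times_cont_diff 4
      (\<lambda>(a :: (real^'d) \<times> (real^'d), b :: (real^'d) \<times> (real^'d)). h ((norm (a - b))\<^sup>2))"
    and deriv_h: "0 \<le> r \<Longrightarrow> (h has_real_derivative h' r) (at r within {0..})"
    and deriv_h': "0 \<le> r \<Longrightarrow> (h' has_real_derivative h'' r) (at r within {0..})"
    and cont_h'': "continuous_on {0..} h''"
begin

abbreviation f :: "(real^'d) \<times> (real^'d) \<Rightarrow> 'w \<Rightarrow> real" where
  "f \<equiv> block_field u"

abbreviation z :: "(real^'d) \<times> (real^'d)" where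
  "z \<equiv> (zs, zs)"

abbreviation D1 :: "(real^'d) \<times> (real^'d) \<Rightarrow> (real^'d) \<times> (real^'d) \<Rightarrow> 'w \<Rightarrow> real" where
  "D1 e a \<equiv> ms_deriv M f e a"

abbreviation D2 ::
    "(real^'d) \<times> (real^'d) \<Rightarrow> (real^'d) \<times> (real^'d) \<Rightarrow> (real^'d) \<times> (real^'d) \<Rightarrow> 'w \<Rightarrow> real" where
  "D2 e' e a \<equiv> ms_deriv M (ms_deriv M f e) e' a"

definition block_kernel :: "((real^'d) \<times> (real^'d)) \<times> ((real^'d) \<times> (real^'d)) \<Rightarrow> real" where
  "block_kernel p = 2 * (h ((norm (fst p - snd p))\<^sup>2) - h ((norm (fst p - prod.swap (snd p)))\<^sup>2))"

text \<open>
  Expanding the product \<open>f(a) f(b)\<close> gives four terms, which the isometry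
  \<open>prod.swap\<close> identifies in pairs. The four-term form inherits its smoothness from the
  base kernel.
\<close>
lemma block_kernel_eq:
  "block_kernel = (\<lambda>p. (\<lambda>(a, b). h ((norm (a - b))\<^sup>2)) p
      - (\<lambda>(a, b). h ((norm (a - b))\<^sup>2)) (fst p, prod.swap (snd p))
      - ((\<lambda>(a, b). h ((norm (a - b))\<^sup>2)) (prod.swap (fst p), snd p)
        - (\<lambda>(a, b). h ((norm (a - b))\<^sup>2)) (prod.swap (fst p), prod.swap (snd p))))"
proof
  fix p :: "((real^'d) \<times> (real^'d)) \<times> ((real^'d) \<times> (real^'d))"
  have "norm (prod.swap (fst p) - prod.swap (snd p)) = norm (fst p - snd p)"
    using norm_swap[of "fst p - snd p"] by (simp add: swap_diff)
  then show "block_kernel p = (\<lambda>(a, b). h ((norm (a - b))\<^sup>2)) p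
      - (\<lambda>(a, b). h ((norm (a - b))\<^sup>2)) (fst p, prod.swap (snd p))
      - ((\<lambda>(a, b). h ((norm (a - b))\<^sup>2)) (prod.swap (fst p), snd p)
        - (\<lambda>(a, b). h ((norm (a - b))\<^sup>2)) (prod.swap (fst p), prod.swap (snd p)))"
    by (simp add: block_kernel_def norm_swap_diff split_beta)
qed

lemma kernel: "second_moment_kernel M f block_kernel"
  unfolding block_kernel_eq by (rule second_moment_kernel_block_field[OF kernel_base])

lemma smooth: "n_times_cont_diff (Suc (Suc (Suc (Suc 0)))) block_kernel"
proof -
  have "n_times_cont_diff 4 block_kernel"
    unfolding block_kernel_eq by (rule n_times_cont_diff_block_kernel[OF smooth_base])
  moreover have "(4 :: nat) = Suc (Suc (Suc (Suc 0)))" by simp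
  ultimately show ?thesis by (simp only:)
qed

lemmas kernel_D1 = second_moment_kernel_ms_deriv[OF kernel smooth]
lemmas smooth_D1 = n_times_cont_diff_mixed_derivative[OF smooth]

lemma f_L2: "f a \<in> L2 M"
  by (rule second_moment_kernel_L2[OF kernel])

lemma expectation_f_f:
  "(\<integral>\<omega>. f a \<omega> * f b \<omega> \<partial>M) = 2 * (h ((norm (a - b))\<^sup>2) - h ((norm (a - prod.swap b))\<^sup>2))"
  by (simp add: second_moment_kernel_eq[OF kernel] block_kernel_def)

lemma mean_f: "(\<integral>\<omega>. f a \<omega> \<partial>M) = 0"
proof -
  have "integrable M (u a)" for a
    using L2_integrable_mult[OF second_moment_kernel_L2[OF kernel_base] L2_const[of 1], of a] by simp
  then show ?thesis by (simp add: block_field_def mean_base)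
qed

lemma has_D1: "has_ms_derivative M f e a (D1 e a)"
  by (rule has_ms_derivative_ms_deriv[OF kernel smooth])

lemma has_D2: "has_ms_derivative M (D1 e) e' a (D2 e' e a)"
  by (rule has_ms_derivative_ms_deriv[OF kernel_D1 smooth_D1])

lemma D1_L2: "D1 e a \<in> L2 M"
  by (rule has_ms_derivative_L2[OF has_D1])

lemma D2_L2: "D2 e' e a \<in> L2 M"
  by (rule has_ms_derivative_L2[OF has_D2])

lemma expectation_f_D1:
  "(\<integral>\<omega>. f y \<omega> * D1 e a \<omega> \<partial>M) = 4 * (h' ((norm (a - y))\<^sup>2) * ((a - y) \<bullet> e)
      - h' ((norm (a - prod.swap y))\<^sup>2) * ((a - prod.swap y) \<bullet> e))"
proof (rule DERIV_unique)
  show "((\<lambda>t. \<integral>\<omega>. f y \<omega> * f (a + t *\<^sub>R e) \<omega> \<partial>M) has_real_derivative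
      (\<integral>\<omega>. f y \<omega> * D1 e a \<omega> \<partial>M)) (at 0)"
    by (rule has_real_derivative_expectation_mult[OF f_L2 f_L2 has_D1])
  have eq: "(\<integral>\<omega>. f y \<omega> * f b \<omega> \<partial>M) = 2 * (h ((norm (b - y))\<^sup>2) - h ((norm (b - prod.swap y))\<^sup>2))" for b
    using expectation_f_f[of b y] by (simp add: mult.commute)
  show "((\<lambda>t. \<integral>\<omega>. f y \<omega> * f (a + t *\<^sub>R e) \<omega> \<partial>M) has_real_derivative
      4 * (h' ((norm (a - y))\<^sup>2) * ((a - y) \<bullet> e)
        - h' ((norm (a - prod.swap y))\<^sup>2) * ((a - prod.swap y) \<bullet> e))) (at 0)"
    unfolding eq
    using DERIV_cmult[OF DERIV_diff[
        OF has_real_derivative_norm_square_line[OF deriv_h, of a y e]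
          has_real_derivative_norm_square_line[OF deriv_h, of a "prod.swap y" e]], of 2]
    by (simp add: algebra_simps)
qed

lemma norm_z_minus_swap: "norm (z - prod.swap y) = norm (z - y)"
  using norm_swap[of "z - y"] by (simp add: swap_diff)

lemma z_minus_swap: "z - prod.swap y = - prod.swap (y - z)"
  by (simp add: prod_eq_iff)

lemma expectation_f_D1_z:
  "(\<integral>\<omega>. f y \<omega> * D1 e z \<omega> \<partial>M)
    = - 4 * h' ((norm (y - z))\<^sup>2) * ((y - z) \<bullet> e - prod.swap (y - z) \<bullet> e)"
  unfolding expectation_f_D1 norm_z_minus_swap z_minus_swap
  by (simp add: norm_swap norm_minus_commute[of z] inner_diff_left algebra_simps)

text \<open>
  Each of the two products in \<open>expectation_f_D1\<close> contributes a term with \<open>h'\<close>. Both have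
  the coefficient \<open>e' \<bullet> e\<close> and, since \<open>z\<close> is fixed by the swap, with the same argument: they cancel.
\<close>
lemma expectation_f_D2_z:
  "(\<integral>\<omega>. f y \<omega> * D2 e' e z \<omega> \<partial>M) = 8 * h'' ((norm (y - z))\<^sup>2)
    * (((y - z) \<bullet> e') * ((y - z) \<bullet> e) - (prod.swap (y - z) \<bullet> e') * (prod.swap (y - z) \<bullet> e))"
proof (rule DERIV_unique)
  show "((\<lambda>t. \<integral>\<omega>. f y \<omega> * D1 e (z + t *\<^sub>R e') \<omega> \<partial>M) has_real_derivative
      (\<integral>\<omega>. f y \<omega> * D2 e' e z \<omega> \<partial>M)) (at 0)"
    by (rule has_real_derivative_expectation_mult[OF D1_L2 f_L2 has_D2])
  have line: "((\<lambda>t. h' ((norm (z + t *\<^sub>R e' - w))\<^sup>2) * ((z + t *\<^sub>R e' - w) \<bullet> e)) has_real_derivative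
      2 * h'' ((norm (z - w))\<^sup>2) * ((z - w) \<bullet> e') * ((z - w) \<bullet> e)
        + h' ((norm (z - w))\<^sup>2) * (e' \<bullet> e)) (at 0)" for w
  proof -
    have "((\<lambda>t. (z + t *\<^sub>R e' - w) \<bullet> e) has_real_derivative e' \<bullet> e) (at 0)"
      unfolding inner_add_left inner_diff_left inner_scaleR_left
      by (auto intro!: derivative_eq_intros)
    from DERIV_mult[OF has_real_derivative_norm_square_line[OF deriv_h'] this]
    show ?thesis by (simp add: add.commute mult.commute)
  qed
  show "((\<lambda>t. \<integral>\<omega>. f y \<omega> * D1 e (z + t *\<^sub>R e') \<omega> \<partial>M) has_real_derivative
      8 * h'' ((norm (y - z))\<^sup>2)
    * (((y - z) \<bullet> e') * ((y - z) \<bullet> e) - (prod.swap (y - z) \<bullet> e') * (prod.swap (y - z) \<bullet> e))) (at 0)"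
    unfolding expectation_f_D1
  proof (rule DERIV_cong[OF DERIV_cmult[OF DERIV_diff[OF line line]]])
    have "z - y = - (y - z)" by simp
    then show "4 * (2 * h'' ((norm (z - y))\<^sup>2) * ((z - y) \<bullet> e') * ((z - y) \<bullet> e)
        + h' ((norm (z - y))\<^sup>2) * (e' \<bullet> e)
      - (2 * h'' ((norm (z - prod.swap y))\<^sup>2) * ((z - prod.swap y) \<bullet> e') * ((z - prod.swap y) \<bullet> e)
        + h' ((norm (z - prod.swap y))\<^sup>2) * (e' \<bullet> e)))
      = 8 * h'' ((norm (y - z))\<^sup>2)
        * (((y - z) \<bullet> e') * ((y - z) \<bullet> e) - (prod.swap (y - z) \<bullet> e') * (prod.swap (y - z) \<bullet> e))"
      unfolding norm_z_minus_swap z_minus_swap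
      by (simp only: norm_minus_cancel inner_minus_left norm_swap) (simp add: algebra_simps)
  qed
qed

section \<open>The Taylor approximation tested against the field\<close>

text \<open>
  The inner product of \<open>Z\<close> with a derivative is the derivative of the inner product, here of
  the zero function. With \<open>Z = 1\<close> this shows that derivatives have mean zero.
\<close>
lemma
  assumes Z: "Z \<in> L2 M" and orth: "\<And>b. (\<integral>\<omega>. Z \<omega> * f b \<omega> \<partial>M) = 0"
  shows orthogonal_D1: "(\<integral>\<omega>. Z \<omega> * D1 e a \<omega> \<partial>M) = 0"
    and orthogonal_D2: "(\<integral>\<omega>. Z \<omega> * D2 e' e a \<omega> \<partial>M) = 0"
proof -
  show 1: "(\<integral>\<omega>. Z \<omega> * D1 e a \<omega> \<partial>M) = 0" for e a
    using has_real_derivative_expectation_mult[OF f_L2 Z has_D1, of a e]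
    unfolding orth by (rule DERIV_unique) (rule DERIV_const)
  show "(\<integral>\<omega>. Z \<omega> * D2 e' e a \<omega> \<partial>M) = 0"
    using has_real_derivative_expectation_mult[OF D1_L2 Z has_D2, of e a e']
    unfolding 1 by (rule DERIV_unique) (rule DERIV_const)
qed

lemma skew_taylor2_eq_sum:
  "skew_taylor2 M f zs x \<omega> =
    (\<Sum>i\<in>UNIV. (fst (x - z) $ i - snd (x - z) $ i) * D1 (e1 i) z \<omega>)
    + ((\<Sum>(i, j)\<in>UNIV. (fst (x - z) $ i * fst (x - z) $ j - snd (x - z) $ i * snd (x - z) $ j) / 2
          * D2 (e1 i) (e1 j) z \<omega>)
      + (\<Sum>(i, j)\<in>UNIV. fst (x - z) $ i * snd (x - z) $ j * D2 (e1 i) (e2 j) z \<omega>))"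
proof -
  define v w where "v = fst (x - z)" and "w = snd (x - z)"
  have bilinear: "a \<bullet> (A *v b) = (\<Sum>(i, j)\<in>UNIV. a $ i * b $ j * A $ i $ j)"
    for a b :: "real^'d" and A :: "real^'d^'d"
    unfolding UNIV_Times_UNIV[symmetric] sum.cartesian_product[symmetric]
    by (simp add: inner_vec_def matrix_vector_mult_def sum_distrib_left mult_ac)
  have "1 / 2 * (v \<bullet> (hess11 M f z \<omega> *v v) - w \<bullet> (hess11 M f z \<omega> *v w))
      = (\<Sum>(i, j)\<in>UNIV. (v $ i * v $ j - w $ i * w $ j) / 2 * D2 (e1 i) (e1 j) z \<omega>)"
    unfolding bilinear sum_subtractf[symmetric] sum_distrib_left
    by (intro sum.cong refl) (simp add: hess11_def split_beta algebra_simps diff_divide_distrib)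
  moreover have "v \<bullet> (hess12 M f z \<omega> *v w) = (\<Sum>(i, j)\<in>UNIV. v $ i * w $ j * D2 (e1 i) (e2 j) z \<omega>)"
    unfolding bilinear by (simp add: hess12_def)
  moreover have "grad1 M f z \<omega> \<bullet> (v - w) = (\<Sum>i\<in>UNIV. (v $ i - w $ i) * D1 (e1 i) z \<omega>)"
    by (simp add: grad1_def inner_vec_def mult.commute)
  ultimately show ?thesis
    unfolding skew_taylor2_def Let_def v_def w_def by simp
qed

lemma inner_e1: "a \<bullet> e1 i = fst a $ i" and inner_e2: "a \<bullet> e2 i = snd a $ i"
  by (simp_all add: e1_def e2_def inner_prod_def inner_axis)

lemma skew_taylor2_L2: "skew_taylor2 M f zs x \<in> L2 M"
  unfolding skew_taylor2_eq_sum[abs_def] split_beta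
  by (intro L2_add L2_sum L2_scale D1_L2 D2_L2)

lemma expectation_mult_skew_taylor2:
  assumes Z: "Z \<in> L2 M"
  shows "(\<integral>\<omega>. Z \<omega> * skew_taylor2 M f zs x \<omega> \<partial>M) =
    (\<Sum>i\<in>UNIV. (fst (x - z) $ i - snd (x - z) $ i) * (\<integral>\<omega>. Z \<omega> * D1 (e1 i) z \<omega> \<partial>M))
    + ((\<Sum>(i, j)\<in>UNIV. (fst (x - z) $ i * fst (x - z) $ j - snd (x - z) $ i * snd (x - z) $ j) / 2
          * (\<integral>\<omega>. Z \<omega> * D2 (e1 i) (e1 j) z \<omega> \<partial>M))
      + (\<Sum>(i, j)\<in>UNIV. fst (x - z) $ i * snd (x - z) $ j * (\<integral>\<omega>. Z \<omega> * D2 (e1 i) (e2 j) z \<omega> \<partial>M)))"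
  unfolding skew_taylor2_eq_sum split_beta
  by (simp only: expectation_mult_add[OF Z] expectation_mult_sum[OF Z]
      L2_add L2_sum L2_scale D1_L2 D2_L2)

lemma orthogonal_skew_taylor2:
  assumes "Z \<in> L2 M" "\<And>b. (\<integral>\<omega>. Z \<omega> * f b \<omega> \<partial>M) = 0"
  shows "(\<integral>\<omega>. Z \<omega> * skew_taylor2 M f zs x \<omega> \<partial>M) = 0"
  using assms by (simp add: expectation_mult_skew_taylor2 orthogonal_D1 orthogonal_D2)

text \<open>
  With \<open>x - z = (v, w)\<close> and \<open>y - z = (p, r)\<close> the second-order part, divided by
  \<open>4 h''(|y - z|\<^sup>2)\<close>, is
  \<open>(v p)\<^sup>2 - (v r)\<^sup>2 - (w p)\<^sup>2 + (w r)\<^sup>2 + 2 ((v p) (w r) - (v r) (w p))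
   = (v p + w r)\<^sup>2 - (v r + w p)\<^sup>2\<close>.
\<close>
lemma expectation_f_skew_taylor2:
  "(\<integral>\<omega>. f y \<omega> * skew_taylor2 M f zs x \<omega> \<partial>M) =
    - 4 * h' ((norm (y - z))\<^sup>2) * ((x - z) \<bullet> (y - z) - (x - z) \<bullet> prod.swap (y - z))
    + 4 * h'' ((norm (y - z))\<^sup>2) * (((x - z) \<bullet> (y - z))\<^sup>2 - ((x - z) \<bullet> prod.swap (y - z))\<^sup>2)"
proof -
  obtain v w where vw: "x - z = (v, w)" by fastforce
  obtain p r where pr: "y - z = (p, r)" by fastforce
  have prod: "(\<Sum>(i, j)\<in>UNIV. (a $ i * b $ j) * (c $ i * d $ j)) = (a \<bullet> c) * (b \<bullet> d)"
    for a b c d :: "real^'d"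
    unfolding UNIV_Times_UNIV[symmetric] sum.cartesian_product[symmetric] inner_vec_def sum_product
    by (simp add: mult_ac)
  let ?H = "h'' ((norm (y - z))\<^sup>2)"
  have g: "(\<Sum>i\<in>UNIV. (v $ i - w $ i) * (\<integral>\<omega>. f y \<omega> * D1 (e1 i) z \<omega> \<partial>M))
      = - 4 * h' ((norm (y - z))\<^sup>2) * ((v - w) \<bullet> (p - r))"
    unfolding expectation_f_D1_z inner_e1 pr inner_vec_def sum_distrib_left
    by (simp add: mult_ac)
  have "(\<Sum>(i, j)\<in>UNIV. (v $ i * v $ j - w $ i * w $ j) / 2 * (\<integral>\<omega>. f y \<omega> * D2 (e1 i) (e1 j) z \<omega> \<partial>M))
      = 4 * ?H * (\<Sum>(i, j)\<in>UNIV. (v $ i * v $ j) * (p $ i * p $ j) - (v $ i * v $ j) * (r $ i * r $ j)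
        - ((w $ i * w $ j) * (p $ i * p $ j) - (w $ i * w $ j) * (r $ i * r $ j)))"
    unfolding expectation_f_D2_z inner_e1 pr sum_distrib_left
    by (intro sum.cong refl) (simp add: split_beta field_simps)
  also have "\<dots> = 4 * ?H * (((v \<bullet> p)\<^sup>2 - (v \<bullet> r)\<^sup>2) - ((w \<bullet> p)\<^sup>2 - (w \<bullet> r)\<^sup>2))"
    using prod[of v v p p] prod[of v v r r] prod[of w w p p] prod[of w w r r]
    by (simp add: split_beta sum_subtractf power2_eq_square)
  finally have H11: "(\<Sum>(i, j)\<in>UNIV. (v $ i * v $ j - w $ i * w $ j) / 2
        * (\<integral>\<omega>. f y \<omega> * D2 (e1 i) (e1 j) z \<omega> \<partial>M))
      = 4 * ?H * (((v \<bullet> p)\<^sup>2 - (v \<bullet> r)\<^sup>2) - ((w \<bullet> p)\<^sup>2 - (w \<bullet> r)\<^sup>2))" .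
  have "(\<Sum>(i, j)\<in>UNIV. v $ i * w $ j * (\<integral>\<omega>. f y \<omega> * D2 (e1 i) (e2 j) z \<omega> \<partial>M))
      = 8 * ?H * (\<Sum>(i, j)\<in>UNIV. (v $ i * w $ j) * (p $ i * r $ j) - (v $ i * w $ j) * (r $ i * p $ j))"
    unfolding expectation_f_D2_z inner_e1 inner_e2 pr sum_distrib_left
    by (intro sum.cong refl) (simp add: split_beta algebra_simps)
  also have "\<dots> = 8 * ?H * ((v \<bullet> p) * (w \<bullet> r) - (v \<bullet> r) * (w \<bullet> p))"
    using prod[of v w p r] prod[of v w r p] by (simp add: split_beta sum_subtractf)
  finally have H12: "(\<Sum>(i, j)\<in>UNIV. v $ i * w $ j * (\<integral>\<omega>. f y \<omega> * D2 (e1 i) (e2 j) z \<omega> \<partial>M))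
      = 8 * ?H * ((v \<bullet> p) * (w \<bullet> r) - (v \<bullet> r) * (w \<bullet> p))" .
  show ?thesis
    unfolding expectation_mult_skew_taylor2[OF f_L2] vw fst_conv snd_conv g H11 H12
    unfolding pr swap_simp inner_Pair
    by (simp add: inner_diff_left inner_diff_right power2_eq_square algebra_simps)
qed

section \<open>Taylor approximations along a ray\<close>

text \<open>
  The usual Taylor polynomial of \<open>t \<mapsto> f(z + t (x - z))\<close> at \<open>t = 1\<close>. Its inner products
  reduce to calculus in one variable, while those of \<open>skew_taylor2\<close> involve all coordinate
  directions.
\<close>
definition ray_taylor2 :: "(real^'d) \<times> (real^'d) \<Rightarrow> 'w \<Rightarrow> real" where
  "ray_taylor2 x \<omega> = D1 (x - z) z \<omega> + (1 / 2) * D2 (x - z) (x - z) z \<omega>"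

lemma ray_taylor2_L2: "ray_taylor2 x \<in> L2 M"
  unfolding ray_taylor2_def[abs_def] by (intro L2_add L2_scale D1_L2 D2_L2)

lemma expectation_mult_ray_taylor2:
  assumes "Z \<in> L2 M"
  shows "(\<integral>\<omega>. Z \<omega> * ray_taylor2 x \<omega> \<partial>M)
    = (\<integral>\<omega>. Z \<omega> * D1 (x - z) z \<omega> \<partial>M) + (1 / 2) * (\<integral>\<omega>. Z \<omega> * D2 (x - z) (x - z) z \<omega> \<partial>M)"
  unfolding ray_taylor2_def expectation_mult_add[OF assms D1_L2 L2_scale[OF D2_L2]]
  by (simp add: mult.left_commute)

lemma expectation_f_ray_taylor2:
  "(\<integral>\<omega>. f y \<omega> * ray_taylor2 x \<omega> \<partial>M) = (\<integral>\<omega>. f y \<omega> * skew_taylor2 M f zs x \<omega> \<partial>M)"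
  unfolding expectation_mult_ray_taylor2[OF f_L2] expectation_f_skew_taylor2
    expectation_f_D1_z expectation_f_D2_z
  by (simp add: inner_commute power2_eq_square)

text \<open>
  The difference of the two approximations at \<open>y\<close> is orthogonal to all values of \<open>f\<close>, hence to
  the derivatives of \<open>f\<close> that make up the approximation at \<open>x\<close>.
\<close>
lemma expectation_skew_taylor2_ray_taylor2:
  "(\<integral>\<omega>. skew_taylor2 M f zs x \<omega> * skew_taylor2 M f zs y \<omega> \<partial>M)
    = (\<integral>\<omega>. skew_taylor2 M f zs x \<omega> * ray_taylor2 y \<omega> \<partial>M)"
proof -
  define W where "W \<omega> = skew_taylor2 M f zs y \<omega> - ray_taylor2 y \<omega>" for \<omega>
  have W: "W \<in> L2 M"
    unfolding W_def[abs_def] by (rule L2_diff[OF skew_taylor2_L2 ray_taylor2_L2])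
  have "(\<integral>\<omega>. W \<omega> * f b \<omega> \<partial>M) = 0" for b
    using expectation_mult_diff[OF f_L2 skew_taylor2_L2 ray_taylor2_L2, of b y y]
      expectation_f_ray_taylor2[of b y]
    by (simp add: W_def mult.commute)
  from orthogonal_skew_taylor2[OF W this, of x]
  show ?thesis
    using expectation_mult_diff[OF skew_taylor2_L2 skew_taylor2_L2 ray_taylor2_L2, of x y y]
    by (simp add: W_def mult.commute)
qed

text \<open>
  With \<open>\<psi>(s) = E (S f(z + s \<delta>))\<close>, where \<open>S\<close> is the approximation at \<open>x\<close> and \<open>\<delta> = y - z\<close>,
  the inner product with the ray polynomial at \<open>y\<close> is \<open>\<psi>'(0) + \<psi>''(0) / 2\<close>. Both derivatives are
  known to exist because \<open>f\<close> is twice differentiable in mean square. Their values are the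
  coefficients in the expansion of the explicit form of \<open>\<psi>\<close>.
\<close>
lemma expectation_skew_taylor2_skew_taylor2:
  "(\<integral>\<omega>. skew_taylor2 M f zs x \<omega> * skew_taylor2 M f zs y \<omega> \<partial>M) =
    - 4 * h' 0 * ((x - z) \<bullet> (y - z) - (x - z) \<bullet> prod.swap (y - z))
    + 4 * h'' 0 * (((x - z) \<bullet> (y - z))\<^sup>2 - ((x - z) \<bullet> prod.swap (y - z))\<^sup>2)"
proof -
  define \<delta> where "\<delta> = y - z"
  define P Q where "P = (x - z) \<bullet> \<delta> - (x - z) \<bullet> prod.swap \<delta>"
    and "Q = ((x - z) \<bullet> \<delta>)\<^sup>2 - ((x - z) \<bullet> prod.swap \<delta>)\<^sup>2"
  define S where "S = skew_taylor2 M f zs x"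
  have S: "S \<in> L2 M" unfolding S_def by (rule skew_taylor2_L2)
  define \<psi> \<psi>' \<eta> where "\<psi> s = (\<integral>\<omega>. S \<omega> * f (z + s *\<^sub>R \<delta>) \<omega> \<partial>M)"
    and "\<psi>' s = (\<integral>\<omega>. S \<omega> * D1 \<delta> (z + s *\<^sub>R \<delta>) \<omega> \<partial>M)"
    and "\<eta> s = h' ((norm (z + s *\<^sub>R \<delta> - z))\<^sup>2)" for s :: real
  define c where "c = (\<integral>\<omega>. S \<omega> * D2 \<delta> \<delta> z \<omega> \<partial>M)"
  have \<psi>_eq: "\<psi> s = - 4 * P * (s * \<eta> s) + 4 * Q * (s\<^sup>2 * h'' ((norm (s *\<^sub>R \<delta>))\<^sup>2))" for s
  proof -
    have swap: "prod.swap (s *\<^sub>R \<delta>) = s *\<^sub>R prod.swap \<delta>" by (simp add: prod_eq_iff)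
    have line: "z + s *\<^sub>R \<delta> - z = s *\<^sub>R \<delta>" by simp
    have "\<psi> s = (\<integral>\<omega>. f (z + s *\<^sub>R \<delta>) \<omega> * S \<omega> \<partial>M)"
      unfolding \<psi>_def by (simp add: mult.commute)
    then show ?thesis
      unfolding S_def \<eta>_def P_def Q_def expectation_f_skew_taylor2 line swap inner_scaleR_right
      by (simp only: power_mult_distrib) (simp only: algebra_simps)
  qed
  have \<psi>: "(\<psi> has_real_derivative \<psi>' s) (at s)" for s
    unfolding \<psi>_def[abs_def] \<psi>'_def
    using line_derivative_shift[where f = "\<lambda>a. \<integral>\<omega>. S \<omega> * f a \<omega> \<partial>M"
        and f' = "\<lambda>a. \<integral>\<omega>. S \<omega> * D1 \<delta> a \<omega> \<partial>M",
        OF has_real_derivative_expectation_mult[OF f_L2 S has_D1]] .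
  have \<psi>': "(\<psi>' has_real_derivative c) (at 0)"
    unfolding \<psi>'_def[abs_def] c_def
    by (rule has_real_derivative_expectation_mult[OF D1_L2 S has_D2])
  \<comment> \<open>The derivative of \<open>s\<^sup>2 |\<delta>|\<^sup>2\<close> vanishes at 0, so \<open>\<eta>\<close> adds no term of order \<open>s\<^sup>2\<close> to \<open>\<psi>\<close>.\<close>
  have \<eta>: "(\<eta> has_real_derivative 0) (at 0)"
    using has_real_derivative_norm_square_line[OF deriv_h', of z z \<delta>] by (simp add: \<eta>_def[abs_def])
  have \<eta>_lim: "(\<eta> \<longlongrightarrow> h' 0) (at 0)"
    using DERIV_isCont[OF \<eta>] by (simp add: isCont_def \<eta>_def)
  have h''_lim: "((\<lambda>s. h'' ((norm (s *\<^sub>R \<delta>))\<^sup>2)) \<longlongrightarrow> h'' 0) (at 0)"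
  proof -
    have "continuous_on UNIV (\<lambda>s :: real. h'' ((norm (s *\<^sub>R \<delta>))\<^sup>2))"
      by (rule continuous_on_compose2[OF cont_h'']) (auto intro!: continuous_intros)
    then have "isCont (\<lambda>s :: real. h'' ((norm (s *\<^sub>R \<delta>))\<^sup>2)) 0"
      unfolding continuous_on_eq_continuous_at[OF open_UNIV] by blast
    then show ?thesis by (simp add: isCont_def)
  qed
  have \<psi>0: "\<psi> 0 = 0" by (simp add: \<psi>_eq)
  have \<psi>'0: "\<psi>' 0 = - 4 * P * h' 0"
  proof (rule LIM_unique)
    show "((\<lambda>s. \<psi> s / s) \<longlongrightarrow> \<psi>' 0) (at 0)"
      using \<psi>[of 0] by (simp add: DERIV_def \<psi>0)
    have "((\<lambda>s. - 4 * P * \<eta> s + 4 * Q * (s * h'' ((norm (s *\<^sub>R \<delta>))\<^sup>2)))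
        \<longlongrightarrow> - 4 * P * h' 0 + 4 * Q * (0 * h'' 0)) (at 0)"
      by (intro tendsto_intros \<eta>_lim h''_lim)
    moreover have "\<forall>\<^sub>F s in at 0. - 4 * P * \<eta> s + 4 * Q * (s * h'' ((norm (s *\<^sub>R \<delta>))\<^sup>2)) = \<psi> s / s"
      by (auto simp: eventually_at_filter \<psi>_eq field_simps power2_eq_square)
    ultimately show "((\<lambda>s. \<psi> s / s) \<longlongrightarrow> - 4 * P * h' 0) (at 0)"
      by (auto elim: Lim_transform_eventually)
  qed
  have c: "c / 2 = 4 * Q * h'' 0"
  proof (rule LIM_unique)
    show "((\<lambda>s. (\<psi> s - \<psi> 0 - s * \<psi>' 0) / s\<^sup>2) \<longlongrightarrow> c / 2) (at 0)"
      by (rule second_order_Peano[OF \<psi> \<psi>'])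
    have "((\<lambda>s. - 4 * P * ((\<eta> (0 + s) - \<eta> 0) / s) + 4 * Q * h'' ((norm (s *\<^sub>R \<delta>))\<^sup>2))
        \<longlongrightarrow> - 4 * P * 0 + 4 * Q * h'' 0) (at 0)"
      using \<eta> unfolding DERIV_def by (intro tendsto_intros h''_lim)
    moreover have "\<forall>\<^sub>F s in at 0. - 4 * P * ((\<eta> (0 + s) - \<eta> 0) / s) + 4 * Q * h'' ((norm (s *\<^sub>R \<delta>))\<^sup>2)
        = (\<psi> s - \<psi> 0 - s * \<psi>' 0) / s\<^sup>2"
    proof -
      have "\<eta> 0 = h' 0" by (simp add: \<eta>_def)
      then show ?thesis
        by (auto simp: eventually_at_filter \<psi>_eq \<psi>'0 field_simps power2_eq_square)
    qed
    ultimately show "((\<lambda>s. (\<psi> s - \<psi> 0 - s * \<psi>' 0) / s\<^sup>2) \<longlongrightarrow> 4 * Q * h'' 0) (at 0)"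
      by (auto elim: Lim_transform_eventually)
  qed
  have "(\<integral>\<omega>. S \<omega> * ray_taylor2 y \<omega> \<partial>M) = \<psi>' 0 + c / 2"
    unfolding expectation_mult_ray_taylor2[OF S] \<psi>'_def c_def \<delta>_def by simp
  then have "(\<integral>\<omega>. S \<omega> * ray_taylor2 y \<omega> \<partial>M) = - 4 * P * h' 0 + 4 * Q * h'' 0"
    unfolding \<psi>'0 c .
  then show ?thesis
    unfolding expectation_skew_taylor2_ray_taylor2
    by (simp add: S_def P_def Q_def \<delta>_def algebra_simps)
qed

section \<open>The covariance of the error\<close>

lemma mean_skew_taylor2: "(\<integral>\<omega>. skew_taylor2 M f zs x \<omega> \<partial>M) = 0"
  using orthogonal_skew_taylor2[OF L2_const[of 1]] by (simp add: mean_f)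

lemma covariance_error_process:
  "covariance M (error_process M f zs x) (error_process M f zs y) =
      2 * (h ((norm (x - y))\<^sup>2) - h ((norm (x - prod.swap y))\<^sup>2))
    + 4 * (h' ((norm (x - z))\<^sup>2) + h' ((norm (y - z))\<^sup>2) - h' 0)
        * ((x - z) \<bullet> (y - z) - (x - z) \<bullet> prod.swap (y - z))
    - 4 * (h'' ((norm (x - z))\<^sup>2) + h'' ((norm (y - z))\<^sup>2) - h'' 0)
        * (((x - z) \<bullet> (y - z))\<^sup>2 - ((x - z) \<bullet> prod.swap (y - z))\<^sup>2)"
proof -
  let ?S = "skew_taylor2 M f zs"
  have int: "integrable M X" if "X \<in> L2 M" for X
    using L2_integrable_mult[OF that L2_const[of 1]] by simp
  have mean: "(\<integral>\<omega>. error_process M f zs x \<omega> \<partial>M) = 0" for x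
    unfolding error_process_def by (simp add: int skew_taylor2_L2 f_L2 mean_skew_taylor2 mean_f)
  have comm: "(\<integral>\<omega>. ?S x \<omega> * f y \<omega> \<partial>M) = (\<integral>\<omega>. f y \<omega> * ?S x \<omega> \<partial>M)"
    by (simp add: mult.commute)
  have "covariance M (error_process M f zs x) (error_process M f zs y)
      = (\<integral>\<omega>. (?S x \<omega> * ?S y \<omega> - ?S x \<omega> * f y \<omega>) - (f x \<omega> * ?S y \<omega> - f x \<omega> * f y \<omega>) \<partial>M)"
    unfolding covariance_def mean error_process_def by (simp add: algebra_simps)
  also have "\<dots> = (\<integral>\<omega>. ?S x \<omega> * ?S y \<omega> \<partial>M) - (\<integral>\<omega>. f y \<omega> * ?S x \<omega> \<partial>M)
      - ((\<integral>\<omega>. f x \<omega> * ?S y \<omega> \<partial>M) - (\<integral>\<omega>. f x \<omega> * f y \<omega> \<partial>M))"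
    using L2_integrable_mult[OF skew_taylor2_L2 skew_taylor2_L2]
      L2_integrable_mult[OF skew_taylor2_L2 f_L2] L2_integrable_mult[OF f_L2 skew_taylor2_L2]
      L2_integrable_mult[OF f_L2 f_L2]
    by (simp add: comm)
  moreover have "(y - z) \<bullet> (x - z) = (x - z) \<bullet> (y - z)"
      "(y - z) \<bullet> prod.swap (x - z) = (x - z) \<bullet> prod.swap (y - z)"
    using inner_swap[of "y - z" "x - z"] by (simp_all add: inner_commute)
  ultimately show ?thesis
    unfolding expectation_skew_taylor2_skew_taylor2 expectation_f_skew_taylor2 expectation_f_f
    by (simp only:) (simp only: algebra_simps)
qed

end

theorem proposition28:
  fixes M :: "'w measure"
    and u :: "(real^'d::finite) \<times> (real^'d) \<Rightarrow> 'w \<Rightarrow> real"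
    and h h' h'' :: "real \<Rightarrow> real"
    and zs :: "real^'d"
    and x y :: "(real^'d) \<times> (real^'d)"
  defines "f \<equiv> block_field u"
    and "\<Delta>x \<equiv> x - (zs, zs)"
    and "\<Delta>y \<equiv> y - (zs, zs)"
  assumes "prob_space M"
    and "gaussian_field M u"
    and "\<And>a. (\<integral>\<omega>. u a \<omega> \<partial>M) = 0"
    and "\<And>a b. covariance M (u a) (u b) = h ((norm (a - b))\<^sup>2)"
    and "n_times_cont_diff 4 (\<lambda>(a, b). covariance M (u a) (u b))"
    and "\<And>r. 0 \<le> r \<Longrightarrow> (h has_real_derivative h' r) (at r within {0..})"
    and "\<And>r. 0 \<le> r \<Longrightarrow> (h' has_real_derivative h'' r) (at r within {0..})"
    and "continuous_on {0..} h''"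
  shows "covariance M (error_process M f zs x) (error_process M f zs y) =
      2 * (h ((norm (x - y))\<^sup>2) - h ((norm (x - prod.swap y))\<^sup>2))
    + 4 * (h' ((norm \<Delta>x)\<^sup>2) + h' ((norm \<Delta>y)\<^sup>2) - h' 0)
        * (\<Delta>x \<bullet> \<Delta>y - \<Delta>x \<bullet> prod.swap \<Delta>y)
    - 4 * (h'' ((norm \<Delta>x)\<^sup>2) + h'' ((norm \<Delta>y)\<^sup>2) - h'' 0)
        * ((\<Delta>x \<bullet> \<Delta>y)\<^sup>2 - (\<Delta>x \<bullet> prod.swap \<Delta>y)\<^sup>2)"
proof -
  interpret prob_space M by fact
  \<comment> \<open>A field is Gaussian in its linear combinations; a single value is one of them.\<close>
  have "gaussian_rv M (u a)" for a
    using assms(5)[unfolded gaussian_field_def, rule_format, of "{a}" "\<lambda>_. 1"] by simp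
  then have "second_moment_kernel M u (\<lambda>(a, b). h ((norm (a - b))\<^sup>2))"
    using assms(7) by (simp add: second_moment_kernel_def gaussian_rv_L2 covariance_def assms(6))
  then interpret block_isotropic_field M u h h' h'' zs
    using assms by unfold_locales simp_all
  show ?thesis
    unfolding f_def \<Delta>x_def \<Delta>y_def by (rule covariance_error_process)
qed

end
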